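(* For each admissible frequency $\alpha$, there exists an optimal cavity; that is, there exist a real number $\beta_{\min}(\alpha)$ and an admissible cavity $\varepsilon$ such that $\{\alpha-\mathrm{i}\beta_{\min}(\alpha),\varepsilon\}$ is an admissible pair and $\beta_{\min}(\alpha)\le-\operatorname{Im}\tilde\omega$ for every admissible pair $\{\tilde\omega,\tilde\varepsilon\}$ with $\operatorname{Re}\tilde\omega=\alpha$.
   Context: Fixed constants: $l>0$ (cavity length), $c>0$ (speed of light), $\varepsilon_\infty\ge 1$ (permittivity of the outer medium), and $1\le\varepsilon_1<\varepsilon_2$. An admissible cavity is a real function $\varepsilon\in L^\infty(0,l)$ with $\varepsilon_1\le\varepsilon(s)\le\varepsilon_2$ for almost every $s\in(0,l)$. A number $\omega\in\mathbb{C}$ is a quasi-normal (QN) eigenvalue of $\varepsilon$ if the problem $E''(s)=-\frac{\omega^2}{c^2}\varepsilon(s)E(s)$ on $(0,l)$, $E(0)=0$, $\mathrm{i}\omega\frac{\sqrt{\varepsilon_\infty}}{c}E(l)=E'(l)$ has a nontrivial complex-valued solution $E$ (the equation is understood almost everywhere, with $E$ and $E'$ absolutely continuous on $[0,l]$). If $\varepsilon$ is an admissible cavity and $\omega$ is a QN eigenvalue of $\varepsilon$, then $\{\omega,\varepsilon\}$ is called an admissible pair. A real number $\alpha$ is an admissible frequency if $\alpha=\operatorname{Re}\omega$ for some admissible pair $\{\omega,\varepsilon\}$. *)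

theory Defs
  imports "HOL-Analysis.Analysis"
begin

definition abs_continuous_on_interval ::
    "real \<Rightarrow> real \<Rightarrow> (real \<Rightarrow> 'a::real_normed_vector) \<Rightarrow> bool" where
  "abs_continuous_on_interval u v f \<longleftrightarrow>
     (\<forall>e>0. \<exists>d>0. \<forall>(n::nat) a b.
        (\<forall>i<n. u \<le> a i \<and> a i \<le> b i \<and> b i \<le> v) \<and>
        (\<forall>i<n. \<forall>j<n. i \<noteq> j \<longrightarrow> {a i<..<b i} \<inter> {a j<..<b j} = {}) \<and>
        (\<Sum>i<n. b i - a i) < d
        \<longrightarrow> (\<Sum>i<n. norm (f (b i) - f (a i))) < e)"

(* A class in L^\<infinity>(0,l) is given by a Lebesgue measurable representative; its values
   outside (0,l) are irrelevant, and essential boundedness follows from the two bounds. *)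
definition admissible_cavity :: "real \<Rightarrow> real \<Rightarrow> real \<Rightarrow> (real \<Rightarrow> real) \<Rightarrow> bool" where
  "admissible_cavity l eps1 eps2 \<epsilon> \<longleftrightarrow>
     \<epsilon> \<in> borel_measurable (lebesgue_on {0<..<l}) \<and>
     (AE s in lebesgue_on {0<..<l}. eps1 \<le> \<epsilon> s \<and> \<epsilon> s \<le> eps2)"

(* E1 is the derivative E', one-sided at the endpoints.  It exists at every point of [0,l],
   and not only almost everywhere, since E and E' are required to be absolutely continuous. *)
definition qn_solution ::
    "real \<Rightarrow> real \<Rightarrow> real \<Rightarrow> (real \<Rightarrow> real) \<Rightarrow> complex \<Rightarrow> (real \<Rightarrow> complex) \<Rightarrow> bool" where
  "qn_solution l c eps_inf \<epsilon> \<omega> E \<longleftrightarrow>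
     (\<exists>E1. abs_continuous_on_interval 0 l E \<and>
           abs_continuous_on_interval 0 l E1 \<and>
           (\<forall>s\<in>{0..l}. (E has_vector_derivative E1 s) (at s within {0..l})) \<and>
           (AE s in lebesgue_on {0<..<l}.
              (E1 has_vector_derivative
                 - (\<omega>\<^sup>2 / (complex_of_real c)\<^sup>2) * complex_of_real (\<epsilon> s) * E s) (at s)) \<and>
           E 0 = 0 \<and>
           \<i> * \<omega> * complex_of_real (sqrt eps_inf / c) * E l = E1 l)"

definition qn_eigenvalue ::
    "real \<Rightarrow> real \<Rightarrow> real \<Rightarrow> (real \<Rightarrow> real) \<Rightarrow> complex \<Rightarrow> bool" where
  "qn_eigenvalue l c eps_inf \<epsilon> \<omega> \<longleftrightarrow>
     (\<exists>E. qn_solution l c eps_inf \<epsilon> \<omega> E \<and> (\<exists>s\<in>{0..l}. E s \<noteq> 0))"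

definition admissible_pair ::
    "real \<Rightarrow> real \<Rightarrow> real \<Rightarrow> real \<Rightarrow> real \<Rightarrow> complex \<Rightarrow> (real \<Rightarrow> real) \<Rightarrow> bool" where
  "admissible_pair l c eps_inf eps1 eps2 \<omega> \<epsilon> \<longleftrightarrow>
     admissible_cavity l eps1 eps2 \<epsilon> \<and> qn_eigenvalue l c eps_inf \<epsilon> \<omega>"

definition admissible_frequency ::
    "real \<Rightarrow> real \<Rightarrow> real \<Rightarrow> real \<Rightarrow> real \<Rightarrow> real \<Rightarrow> bool" where
  "admissible_frequency l c eps_inf eps1 eps2 \<alpha> \<longleftrightarrow>
     (\<exists>\<omega> \<epsilon>. admissible_pair l c eps_inf eps1 eps2 \<omega> \<epsilon> \<and> \<alpha> = Re \<omega>)"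

end

theory Submission
  imports Defs "HOL-Complex_Analysis.Great_Picard"
begin

text \<open>
  Represent a cavity by its primitive F, which satisfies
  eps1 (t - s) \<le> F t - F s \<le> eps2 (t - s). Integrating by parts, the equation becomes
  E'(s) = E'(0) - (\<omega>/c)^2 (F(s) E(s) - int_0^s F E'),
  which no longer contains \<epsilon> and passes to uniform limits of F, E and E'. Solutions
  normalized by max |(E, E')| = 1 are equi-Lipschitz, so the Arzela-Ascoli theorem plays the role of
  weak-* compactness of the cavities. Along a sequence with Re \<omega> = \<alpha> and Im \<omega>
  tending to its supremum one obtains a limiting solution, which is nontrivial by the normalization;
  the limiting F is again the primitive of a cavity. The supremum is finite because Im \<omega> \<le> 0:
  for W = Re (E' * cnj (i \<omega> E)) one has W(0) = 0, W(l) \<ge> 0 and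
  W' = - Im \<omega> (|E'|^2 + |\<omega>/c|^2 \<epsilon> |E|^2).
\<close>

section \<open>Absolutely continuous functions\<close>

text \<open>A weak limit of cavities has no pointwise description, whereas the limit of their
  primitives is an ordinary function. The price is paid at the end, where a cavity must be recovered
  from the limiting primitive: its two-sided slope bounds survive the limit, and the positive lower
  bound makes it invertible, so that Lebesgue measure can be transported by the inverse and
  differentiated by Radon-Nikodym. Passing between the equation almost everywhere and integral
  identities takes two facts: the fundamental theorem of calculus for absolutely continuous
  functions, and Lebesgue differentiation of indefinite integrals. Both are stated for the
  Henstock-Kurzweil integral. The finite supremum does two jobs. With the real part fixed it makes
  the frequencies converge along the maximizing sequence, and it thereby bounds \<omega>^2/c^2, on
  which the Lipschitz constants of E' depend. The normalization must include E' because those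
  constants need a bound on both E and E'. Primitives are anchored at 0, which bounds them
  uniformly.\<close>

lemma abs_continuous_on_interval_finite_family:
  assumes "abs_continuous_on_interval u v f" and "e > 0"
  shows "\<exists>d>0. \<forall>I a b. finite I \<and> (\<forall>i\<in>I. u \<le> a i \<and> a i \<le> b i \<and> b i \<le> v) \<and>
       (\<forall>i\<in>I. \<forall>j\<in>I. i \<noteq> j \<longrightarrow> {a i<..<b i} \<inter> {a j<..<b j} = {}) \<and>
       (\<Sum>i\<in>I. b i - a i) < d \<longrightarrow> (\<Sum>i\<in>I. norm (f (b i) - f (a i))) < e"
proof -
  obtain d where d0: "d > 0 \<and> (\<forall>(n::nat) a b.
        (\<forall>i<n. u \<le> a i \<and> a i \<le> b i \<and> b i \<le> v) \<and>
        (\<forall>i<n. \<forall>j<n. i \<noteq> j \<longrightarrow> {a i<..<b i} \<inter> {a j<..<b j} = {}) \<and>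
        (\<Sum>i<n. b i - a i) < d
        \<longrightarrow> (\<Sum>i<n. norm (f (b i) - f (a i))) < e)"
    using assms(1)[unfolded abs_continuous_on_interval_def, THEN spec, THEN mp, OF assms(2)] by (rule exE)
  note d = d0[THEN conjunct2, THEN spec, THEN spec, THEN spec]
  have "d > 0" using d0 by (rule conjunct1)
  show ?thesis
  proof (intro exI[of _ d] conjI allI impI, fact, elim conjE)
    fix I :: "'b set" and a b
    assume I: "finite I" "\<forall>i\<in>I. u \<le> a i \<and> a i \<le> b i \<and> b i \<le> v"
      "\<forall>i\<in>I. \<forall>j\<in>I. i \<noteq> j \<longrightarrow> {a i<..<b i} \<inter> {a j<..<b j} = {}"
      "(\<Sum>i\<in>I. b i - a i) < d"
    \<comment> \<open>The definition of absolute continuity admits only index sets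
      \<open>{..<n}\<close>. Later the index set is a part of a tagged division, that is, a finite
      set of tagged intervals, so an enumeration carries the estimate over.\<close>
    obtain h where h: "bij_betw h {..<card I} I"
      using ex_bij_betw_nat_finite[OF I(1)] by (auto simp: lessThan_atLeast0)
    have "(\<Sum>i<card I. norm (f (b (h i)) - f (a (h i)))) < e"
    proof (rule mp[OF d[of "card I" "\<lambda>i. a (h i)" "\<lambda>i. b (h i)"]], intro conjI allI impI)
      fix i assume "i < card I"
      then have "h i \<in> I" using h by (auto simp: bij_betw_def)
      then show "u \<le> a (h i)" "a (h i) \<le> b (h i)" "b (h i) \<le> v" using I(2) by auto
      fix j assume "j < card I" "i \<noteq> j"
      then have "h j \<in> I" "h i \<noteq> h j"
        using h \<open>i < card I\<close> by (auto simp: bij_betw_def inj_on_def)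
      then show "{a (h i)<..<b (h i)} \<inter> {a (h j)<..<b (h j)} = {}"
        using I(3) \<open>h i \<in> I\<close> by blast
    next
      show "(\<Sum>i<card I. b (h i) - a (h i)) < d"
        using sum.reindex_bij_betw[OF h, of "\<lambda>i. b i - a i"] I(4) by simp
    qed
    then show "(\<Sum>i\<in>I. norm (f (b i) - f (a i))) < e"
      using sum.reindex_bij_betw[OF h, of "\<lambda>i. norm (f (b i) - f (a i))"] by simp
  qed
qed

lemma abs_continuous_on_interval_subset:
  assumes "abs_continuous_on_interval u v f" "u \<le> s" "t \<le> v"
  shows "abs_continuous_on_interval s t f"
  unfolding abs_continuous_on_interval_def
proof (intro allI impI)
  fix e :: real assume "e > 0"
  obtain d where d: "d > 0 \<and> (\<forall>(n::nat) a b.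
        (\<forall>i<n. u \<le> a i \<and> a i \<le> b i \<and> b i \<le> v) \<and>
        (\<forall>i<n. \<forall>j<n. i \<noteq> j \<longrightarrow> {a i<..<b i} \<inter> {a j<..<b j} = {}) \<and>
        (\<Sum>i<n. b i - a i) < d
        \<longrightarrow> (\<Sum>i<n. norm (f (b i) - f (a i))) < e)"
    using assms(1)[unfolded abs_continuous_on_interval_def, THEN spec, THEN mp, OF \<open>e > 0\<close>] by (rule exE)
  show "\<exists>d>0. \<forall>(n::nat) a b.
        (\<forall>i<n. s \<le> a i \<and> a i \<le> b i \<and> b i \<le> t) \<and>
        (\<forall>i<n. \<forall>j<n. i \<noteq> j \<longrightarrow> {a i<..<b i} \<inter> {a j<..<b j} = {}) \<and>
        (\<Sum>i<n. b i - a i) < d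
        \<longrightarrow> (\<Sum>i<n. norm (f (b i) - f (a i))) < e"
  proof (intro exI[of _ d] conjI allI impI, rule conjunct1[OF d], elim conjE)
    fix n :: nat and a b
    assume *: "\<forall>i<n. s \<le> a i \<and> a i \<le> b i \<and> b i \<le> t"
      "\<forall>i<n. \<forall>j<n. i \<noteq> j \<longrightarrow> {a i<..<b i} \<inter> {a j<..<b j} = {}" "(\<Sum>i<n. b i - a i) < d"
    have "\<forall>i<n. u \<le> a i \<and> a i \<le> b i \<and> b i \<le> v" using *(1) assms(2,3) by force
    then show "(\<Sum>i<n. norm (f (b i) - f (a i))) < e"
      by (intro mp[OF d[THEN conjunct2, THEN spec, THEN spec, THEN spec, of n a b]] conjI *(2,3))
  qed
qed

lemma lipschitz_on_imp_abs_continuous: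
  fixes f :: "real \<Rightarrow> 'a::real_normed_vector"
  assumes "C-lipschitz_on {u..v} f"
  shows "abs_continuous_on_interval u v f"
  unfolding abs_continuous_on_interval_def
proof (intro allI impI)
  fix e :: real assume "e > 0"
  have "C \<ge> 0" using assms lipschitz_on_nonneg by blast
  show "\<exists>d>0. \<forall>(n::nat) a b.
        (\<forall>i<n. u \<le> a i \<and> a i \<le> b i \<and> b i \<le> v) \<and>
        (\<forall>i<n. \<forall>j<n. i \<noteq> j \<longrightarrow> {a i<..<b i} \<inter> {a j<..<b j} = {}) \<and>
        (\<Sum>i<n. b i - a i) < d
        \<longrightarrow> (\<Sum>i<n. norm (f (b i) - f (a i))) < e"
  proof (intro exI[of _ "e / (C + 1)"] conjI allI impI)
    fix n :: nat and a b
    assume *: "(\<forall>i<n. u \<le> a i \<and> a i \<le> b i \<and> b i \<le> v) \<and>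
        (\<forall>i<n. \<forall>j<n. i \<noteq> j \<longrightarrow> {a i<..<b i} \<inter> {a j<..<b j} = {}) \<and>
        (\<Sum>i<n. b i - a i) < e / (C + 1)"
    have "(\<Sum>i<n. norm (f (b i) - f (a i))) \<le> (\<Sum>i<n. (C + 1) * (b i - a i))"
    proof (rule sum_mono)
      fix i assume "i \<in> {..<n}"
      then have i: "u \<le> a i" "a i \<le> b i" "b i \<le> v" using * by auto
      have "norm (f (b i) - f (a i)) \<le> C * norm (b i - a i)"
        using i by (intro lipschitz_on_normD[OF assms]) auto
      then show "norm (f (b i) - f (a i)) \<le> (C + 1) * (b i - a i)"
        using i by (simp add: algebra_simps)
    qed
    also have "\<dots> = (C + 1) * (\<Sum>i<n. b i - a i)" by (simp add: sum_distrib_left)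
    also have "\<dots> < e" using * \<open>C \<ge> 0\<close> by (simp add: field_simps)
    finally show "(\<Sum>i<n. norm (f (b i) - f (a i))) < e" .
  qed (use \<open>e > 0\<close> \<open>C \<ge> 0\<close> in simp)
qed

text \<open>The increments of \<open>f\<close> over a tagged division telescope to exactly
  \<open>f b - f a\<close>, so it suffices to compare each Riemann term with the increment over its
  own interval. Integrability of \<open>g\<close> comes out as part of the conclusion.\<close>

lemma has_integral_abs_continuous:
  fixes f :: "real \<Rightarrow> 'a::real_normed_vector"
  assumes "a \<le> b" and ac: "abs_continuous_on_interval a b f" and N: "negligible N"
    and der: "\<And>x. x \<in> {a..b} - N \<Longrightarrow> (f has_vector_derivative g x) (at x within {a..b})"
  shows "(g has_integral f b - f a) {a..b}"
proof (cases "a = b")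
  case False
  then have ab: "a < b" using \<open>a \<le> b\<close> by simp
  \<comment> \<open>\<open>g\<close> is arbitrary on \<open>N\<close>. With value 0 there, the
    Riemann terms tagged in \<open>N\<close> vanish and only the increments of \<open>f\<close>
    remain to be estimated.\<close>
  define h where "h x = (if x \<in> N then 0 else g x)" for x
  have "(h has_integral f b - f a) {a..b}"
    unfolding has_integral_factor_content_real
  proof (intro allI impI)
    fix e :: real assume "e > 0"
    \<comment> \<open>Half of the error is spent on the tags in \<open>N\<close>, half on the
      others.\<close>
    define e2 where "e2 = e / 2"
    have "e2 > 0" using \<open>e > 0\<close> by (simp add: e2_def)
    then have "e2 * (b - a) > 0" using ab by simp
    obtain \<delta> where \<delta>0: "\<delta> > 0 \<and>
      (\<forall>(I :: (real \<times> real set) set) u v. finite I \<and> (\<forall>i\<in>I. a \<le> u i \<and> u i \<le> v i \<and> v i \<le> b) \<and>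
       (\<forall>i\<in>I. \<forall>j\<in>I. i \<noteq> j \<longrightarrow> {u i<..<v i} \<inter> {u j<..<v j} = {}) \<and>
       (\<Sum>i\<in>I. v i - u i) < \<delta> \<longrightarrow> (\<Sum>i\<in>I. norm (f (v i) - f (u i))) < e2 * (b - a))"
      using abs_continuous_on_interval_finite_family[OF ac \<open>e2 * (b - a) > 0\<close>] by (rule exE)
    note \<delta> = \<delta>0[THEN conjunct2, THEN spec, THEN spec, THEN spec]
    have "\<delta> > 0" using \<delta>0 by (rule conjunct1)
    have Nn: "N \<in> null_sets lebesgue" using N negligible_iff_null_sets by blast
    obtain U where U: "open U" "N \<subseteq> U" "emeasure lebesgue (U - N) < ennreal \<delta>"
      by (rule sets_lebesgue_outer_open[OF null_setsD2[OF Nn] \<open>\<delta> > 0\<close>])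
    have "emeasure lebesgue U = emeasure lebesgue (U - N)"
      using Nn U by (intro emeasure_Diff_null_set[symmetric]) auto
    then have U\<delta>: "emeasure lborel U < ennreal \<delta>"
      using U by simp
    have "\<forall>x. \<exists>d>0. x \<in> {a..b} - N \<longrightarrow>
         (\<forall>y\<in>{a..b}. norm (y-x) < d \<longrightarrow> norm (f y - f x - (y-x) *\<^sub>R g x) \<le> e2 * norm (y-x))"
      using der[unfolded has_vector_derivative_def has_derivative_within_alt] \<open>e2 > 0\<close> by blast
    then obtain d where d0: "\<And>x. d x > 0"
      and d: "\<And>x y. \<lbrakk>x \<in> {a..b} - N; y \<in> {a..b}; norm (y-x) < d x\<rbrakk>
         \<Longrightarrow> norm (f y - f x - (y-x) *\<^sub>R g x) \<le> e2 * norm (y-x)"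
      by metis
    \<comment> \<open>Intervals tagged in N lie in a small open set, where absolute continuity controls the
      increments of f; elsewhere the derivative does.\<close>
    define \<gamma> where "\<gamma> x = (if x \<in> N then U else ball x (d x))" for x
    have "gauge \<gamma>" using U d0 by (auto simp: gauge_def \<gamma>_def)
    have main: "norm ((\<Sum>(x,k)\<in>p. measure lborel k *\<^sub>R h x) - (f b - f a)) \<le> e * measure lborel {a..b}"
      if p: "p tagged_division_of {a..b}" and fine: "\<gamma> fine p" for p
    proof -
      have fin: "finite p" using p by auto
      have sub: "x \<in> k \<and> k \<subseteq> {a..b} \<and> k = {Inf k..Sup k} \<and> a \<le> Inf k \<and> Inf k \<le> Sup k \<and> Sup k \<le> b \<and> measure lborel k = Sup k - Inf k \<and> k \<subseteq> \<gamma> x"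
        if xk: "(x,k) \<in> p" for x k
      proof -
        have "x \<in> k" "k \<subseteq> {a..b}" using p xk by blast+
        obtain u v where uv: "k = cbox u v" using tagged_division_ofD(4)[OF p xk] by blast
        then have "u \<le> v" using \<open>x \<in> k\<close> by auto
        then show ?thesis using \<open>x \<in> k\<close> \<open>k \<subseteq> {a..b}\<close> uv fine xk by (auto simp: fine_def)
      qed
      have disj: "{Inf k<..<Sup k} \<inter> {Inf k'<..<Sup k'} = {}"
        if "(x,k) \<in> p" "(x',k') \<in> p" "(x,k) \<noteq> (x',k')" for x k x' k'
      proof -
        have "interior k \<inter> interior k' = {}"
          using tagged_division_ofD(5)[OF p] that by blast
        moreover have "interior k = {Inf k<..<Sup k}" "interior k' = {Inf k'<..<Sup k'}"
          using sub[OF that(1)] sub[OF that(2)] interior_atLeastAtMost_real by metis+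
        ultimately show ?thesis by simp
      qed
      define q where "q = {z \<in> p. fst z \<in> N}"
      have finq: "finite q" using fin by (simp add: q_def)
      \<comment> \<open>Members of the division may share endpoints; their interiors are truly
        disjoint, so the lengths add up to the measure of a subset of \<open>U\<close>.\<close>
      have "(\<Sum>z\<in>q. emeasure lborel {Inf (snd z)<..<Sup (snd z)})
          = emeasure lborel (\<Union>z\<in>q. {Inf (snd z)<..<Sup (snd z)})"
      proof (rule sum_emeasure[OF _ _ finq])
        show "disjoint_family_on (\<lambda>z. {Inf (snd z)<..<Sup (snd z)}) q"
          using disj unfolding disjoint_family_on_def q_def by (metis (no_types, lifting) mem_Collect_eq prod.collapse)
      qed auto
      also have "\<dots> \<le> emeasure lborel U"
      proof (rule emeasure_mono)
        have "{Inf k<..<Sup k} \<subseteq> U" if "(x,k) \<in> p" "x \<in> N" for x k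
        proof -
          have "k = {Inf k..Sup k}" "k \<subseteq> U" using sub[OF that(1)] that(2) by (auto simp: \<gamma>_def)
          then show ?thesis using greaterThanLessThan_subseteq_atLeastAtMost_iff by blast
        qed
        then show "(\<Union>z\<in>q. {Inf (snd z)<..<Sup (snd z)}) \<subseteq> U" by (force simp: q_def)
      qed (use U in auto)
      also have "\<dots> < ennreal \<delta>" by fact
      finally have "(\<Sum>z\<in>q. emeasure lborel {Inf (snd z)<..<Sup (snd z)}) < ennreal \<delta>" .
      moreover have "(\<Sum>z\<in>q. emeasure lborel {Inf (snd z)<..<Sup (snd z)})
          = (\<Sum>z\<in>q. ennreal (Sup (snd z) - Inf (snd z)))"
        by (rule sum.cong) (use sub in \<open>force simp: q_def\<close>)+
      moreover have "\<dots> = ennreal (\<Sum>z\<in>q. Sup (snd z) - Inf (snd z))"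
        by (rule sum_ennreal) (use sub in \<open>force simp: q_def\<close>)
      ultimately have lt: "ennreal (\<Sum>z\<in>q. Sup (snd z) - Inf (snd z)) < ennreal \<delta>"
        by simp
      have bounds: "\<forall>z\<in>q. a \<le> Inf (snd z) \<and> Inf (snd z) \<le> Sup (snd z) \<and> Sup (snd z) \<le> b"
        using sub by (force simp: q_def)
      have sumlen: "(\<Sum>z\<in>q. Sup (snd z) - Inf (snd z)) < \<delta>"
        using lt bounds by (subst (asm) ennreal_less_iff) (auto intro!: sum_nonneg)
      have "\<forall>z\<in>q. \<forall>z'\<in>q. z \<noteq> z' \<longrightarrow> {Inf (snd z)<..<Sup (snd z)} \<inter> {Inf (snd z')<..<Sup (snd z')} = {}"
        using disj unfolding q_def by (metis (no_types, lifting) mem_Collect_eq prod.collapse)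
      then have sumq: "(\<Sum>z\<in>q. norm (f (Sup (snd z)) - f (Inf (snd z)))) < e2 * (b - a)"
        by (intro mp[OF \<delta>[of q "\<lambda>z. Inf (snd z)" "\<lambda>z. Sup (snd z)"]] conjI finq bounds sumlen)
      define D where "D = (\<lambda>(x,k). measure lborel k *\<^sub>R h x - (f (Sup k) - f (Inf k)))"
      have fsum: "(\<Sum>(x,k)\<in>p. f (Sup k) - f (Inf k)) = f b - f a"
        using additive_tagged_division_1[OF \<open>a \<le> b\<close> p] .
      have bsum: "(\<Sum>(x,k)\<in>p. Sup k - Inf k) = b - a"
        using additive_tagged_division_1[OF \<open>a \<le> b\<close> p, of "\<lambda>x. x"] .
      have "(\<Sum>(x,k)\<in>p. measure lborel k *\<^sub>R h x) - (f b - f a) = sum D p"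
        unfolding fsum[symmetric] D_def sum_subtractf[symmetric] by (simp add: case_prod_unfold)
      also have "\<dots> = sum D q + sum D (p - q)"
        using sum.subset_diff[of q p D] fin by (simp add: q_def add.commute)
      finally have "norm ((\<Sum>(x,k)\<in>p. measure lborel k *\<^sub>R h x) - (f b - f a)) \<le> norm (sum D q) + norm (sum D (p - q))"
        by (simp add: norm_triangle_ineq)
      also have "norm (sum D q) \<le> (\<Sum>z\<in>q. norm (f (Sup (snd z)) - f (Inf (snd z))))"
        by (rule sum_norm_le) (auto simp: D_def q_def h_def norm_minus_commute)
      also have "norm (sum D (p - q)) \<le> (\<Sum>z\<in>p-q. e2 * (Sup (snd z) - Inf (snd z)))"
      proof (rule sum_norm_le)
        fix z assume z: "z \<in> p - q"
        obtain x k where zxk: "z = (x,k)" by (cases z)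
        have xk: "(x,k) \<in> p" "x \<notin> N" using z zxk by (auto simp: q_def)
        define s t where "s = Inf k" and "t = Sup k"
        have st: "x \<in> {s..t}" "s \<le> t" "a \<le> s" "t \<le> b" "measure lborel k = t - s" "{s..t} \<subseteq> ball x (d x)"
          using sub[OF xk(1)] xk(2) unfolding s_def t_def \<gamma>_def by auto
        have "s \<in> {s..t}" "t \<in> {s..t}" using st(2) by auto
        then have "s \<in> ball x (d x)" "t \<in> ball x (d x)" using st(6) by blast+
        have "norm (f s - f x - (s-x) *\<^sub>R g x) \<le> e2 * norm (s-x)"
          "norm (f t - f x - (t-x) *\<^sub>R g x) \<le> e2 * norm (t-x)"
          using d[of x s] d[of x t] xk st \<open>s \<in> ball x (d x)\<close> \<open>t \<in> ball x (d x)\<close>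
          by (auto simp: dist_real_def abs_minus_commute)
        \<comment> \<open>Straddling: the tag \<open>x\<close> lies between \<open>s\<close> and
          \<open>t\<close>, so the two errors \<open>e2 * norm (s-x)\<close> and
          \<open>e2 * norm (t-x)\<close> add up to \<open>e2 * (t - s)\<close>.\<close>
        then have "norm ((f s - f x - (s-x) *\<^sub>R g x) - (f t - f x - (t-x) *\<^sub>R g x)) \<le> e2 * (t - s)"
          using norm_triangle_ineq4[of "f s - f x - (s-x) *\<^sub>R g x" "f t - f x - (t-x) *\<^sub>R g x"] st
          by (auto simp: algebra_simps)
        moreover have "measure lborel k *\<^sub>R g x = t *\<^sub>R g x - s *\<^sub>R g x"
          using st(5) by (simp add: scaleR_diff_left)
        then have "D z = (f s - f x - (s-x) *\<^sub>R g x) - (f t - f x - (t-x) *\<^sub>R g x)"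
          using xk(2) by (simp add: D_def zxk h_def s_def[symmetric] t_def[symmetric] algebra_simps)
        ultimately show "norm (D z) \<le> e2 * (Sup (snd z) - Inf (snd z))"
          by (simp add: zxk s_def t_def)
      qed
      also have "\<dots> \<le> (\<Sum>z\<in>p. e2 * (Sup (snd z) - Inf (snd z)))"
        by (rule sum_mono2) (use fin sub \<open>e2 > 0\<close> in \<open>force simp: q_def\<close>)+
      also have "\<dots> = e2 * (b - a)"
        unfolding bsum[symmetric] by (simp add: sum_distrib_left case_prod_unfold)
      also note sumq
      finally show ?thesis using ab by (simp add: e2_def)
    qed
    show "\<exists>d. gauge d \<and> (\<forall>p. p tagged_division_of {a..b} \<and> d fine p \<longrightarrow>
        norm ((\<Sum>(x,k)\<in>p. measure lborel k *\<^sub>R h x) - (f b - f a)) \<le> e * measure lborel {a..b})"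
      by (intro exI[of _ \<gamma>] conjI allI impI, fact, elim conjE, rule main)
  qed
  then show ?thesis
    by (rule has_integral_spike[OF N, rotated]) (auto simp: h_def)
qed auto

section \<open>Lebesgue differentiation and densities of bi-Lipschitz functions\<close>

text \<open>The Lebesgue differentiation theorem applied here averages over cubes with lower corner
  \<open>x\<close>. In dimension one these are the intervals \<open>{x..x + r}\<close>, which is why
  only a right derivative results.\<close>

lemma integral_right_derivative_ae:
  fixes h :: "real \<Rightarrow> 'a::euclidean_space"
  assumes "\<And>a b. h integrable_on {a..b}"
  shows "\<exists>N. negligible N \<and> (\<forall>x e. x \<notin> N \<longrightarrow> 0 < e \<longrightarrow> (\<exists>d>0. \<forall>y. x < y \<and> y < x + d \<longrightarrow>
        norm (integral {x..y} h - (y - x) *\<^sub>R h x) \<le> e * (y - x)))"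
proof -
  obtain N where N: "negligible N" "\<And>x e. \<lbrakk>x \<notin> N; 0 < e\<rbrakk> \<Longrightarrow> \<exists>d>0. \<forall>r. 0 < r \<and> r < d \<longrightarrow>
      norm (integral (cbox x (x + r *\<^sub>R One)) h /\<^sub>R r ^ DIM(real) - h x) < e"
    by (rule integrable_ccontinuous_explicit[of h]) (use assms in auto)
  show ?thesis
  proof (intro exI[of _ N] conjI allI impI)
    show "negligible N" by fact
    fix x e :: real assume "x \<notin> N" "0 < e"
    then obtain d where "d > 0" and d: "\<And>r. 0 < r \<and> r < d \<Longrightarrow>
      norm (integral {x..x + r} h /\<^sub>R r - h x) < e"
      using N(2)[OF \<open>x \<notin> N\<close> \<open>0 < e\<close>] by auto
    have "norm (integral {x..y} h - (y - x) *\<^sub>R h x) \<le> e * (y - x)" if y: "x < y" "y < x + d" for y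
    proof -
      have "integral {x..y} h - (y - x) *\<^sub>R h x = (y - x) *\<^sub>R (integral {x..y} h /\<^sub>R (y - x) - h x)"
        using y by (simp add: scaleR_diff_right)
      then have "norm (integral {x..y} h - (y - x) *\<^sub>R h x) = (y - x) * norm (integral {x..y} h /\<^sub>R (y - x) - h x)"
        using y by simp
      also have "\<dots> \<le> (y - x) * e"
        using d[of "y - x"] y by (intro mult_left_mono) auto
      finally show ?thesis by (simp add: mult.commute)
    qed
    then show "\<exists>d>0. \<forall>y. x < y \<and> y < x + d \<longrightarrow>
        norm (integral {x..y} h - (y - x) *\<^sub>R h x) \<le> e * (y - x)"
      using \<open>d > 0\<close> by blast
  qed
qed

text \<open>The left derivative at \<open>x\<close> is the right derivative at \<open>- x\<close>
  for the reflected function. Its exceptional set is reflected back, and reflection is Lipschitz, so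
  the set stays negligible.\<close>

lemma integral_has_vector_derivative_ae:
  fixes h :: "real \<Rightarrow> 'a::euclidean_space"
  assumes h: "h integrable_on {a..b}"
  obtains N where "negligible N"
    "\<And>x. x \<in> {a<..<b} - N \<Longrightarrow> ((\<lambda>s. integral {a..s} h) has_vector_derivative h x) (at x)"
proof -
  \<comment> \<open>Extension by zero gives integrability on every compact interval, which the
    one-sided lemma asks for and which reflection preserves.\<close>
  define h0 where "h0 x = (if x \<in> {a..b} then h x else 0)" for x
  have "h0 integrable_on UNIV"
    using h unfolding h0_def integrable_restrict_UNIV .
  then have i: "h0 integrable_on {u..v}" for u v
    using integrable_on_subinterval[of h0 UNIV u v] by simp
  have i': "(\<lambda>x. h0 (- x)) integrable_on {u..v}" for u v
    using Henstock_Kurzweil_Integration.integrable_reflect_real[where f=h0 and a="- v" and b="- u"] i[of "- v" "- u"] unfolding minus_minus by (rule iffD2)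
  obtain N1 where N1: "negligible N1" and
    N1d: "\<forall>x e. x \<notin> N1 \<longrightarrow> 0 < e \<longrightarrow> (\<exists>d>0. \<forall>y. x < y \<and> y < x + d \<longrightarrow>
        norm (integral {x..y} h0 - (y - x) *\<^sub>R h0 x) \<le> e * (y - x))"
    using integral_right_derivative_ae[OF i] by blast
  obtain N2 where N2: "negligible N2" and
    N2d: "\<forall>x e. x \<notin> N2 \<longrightarrow> 0 < e \<longrightarrow> (\<exists>d>0. \<forall>y. x < y \<and> y < x + d \<longrightarrow>
        norm (integral {x..y} (\<lambda>x. h0 (- x)) - (y - x) *\<^sub>R h0 (- x)) \<le> e * (y - x))"
    using integral_right_derivative_ae[OF i'] by blast
  have "negligible (uminus ` N2)"
  proof (rule negligible_locally_Lipschitz_image[OF _ N2])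
    fix x :: real
    show "\<exists>T B. open T \<and> x \<in> T \<and> (\<forall>y\<in>N2 \<inter> T. norm (- y - - x) \<le> B * norm (y - x))"
      by (intro exI[of _ UNIV] exI[of _ 1]) auto
  qed simp
  show thesis
  proof (rule that[of "N1 \<union> uminus ` N2"])
    show "negligible (N1 \<union> uminus ` N2)" using N1 \<open>negligible (uminus ` N2)\<close> by simp
    fix x assume x: "x \<in> {a<..<b} - (N1 \<union> uminus ` N2)"
    then have "x \<notin> N1" "- x \<notin> N2" by (force simp: image_iff)+
    have hx: "h0 x = h x" using x by (simp add: h0_def)
    show "((\<lambda>s. integral {a..s} h) has_vector_derivative h x) (at x)"
      unfolding has_vector_derivative_def has_derivative_at_alt
    proof (intro conjI allI impI)
      fix e :: real assume "0 < e"
      obtain d1 where d1: "d1 > 0" "\<And>y. \<lbrakk>x < y; y < x + d1\<rbrakk> \<Longrightarrow>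
          norm (integral {x..y} h0 - (y - x) *\<^sub>R h0 x) \<le> e * (y - x)"
        using N1d[rule_format, OF \<open>x \<notin> N1\<close> \<open>0 < e\<close>] by blast
      obtain d2 where d2: "d2 > 0" "\<And>y. \<lbrakk>- x < y; y < - x + d2\<rbrakk> \<Longrightarrow>
          norm (integral {- x..y} (\<lambda>x. h0 (- x)) - (y + x) *\<^sub>R h0 x) \<le> e * (y + x)"
        using N2d[rule_format, OF \<open>- x \<notin> N2\<close> \<open>0 < e\<close>] by auto
      have eqi: "integral {s..t} h0 = integral {s..t} h" if "a \<le> s" "t \<le> b" for s t
        by (rule integral_cong) (use that in \<open>auto simp: h0_def\<close>)
      have comb: "integral {a..s} h + integral {s..t} h = integral {a..t} h" if "a \<le> s" "s \<le> t" "t \<le> b" for s t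
        by (rule Henstock_Kurzweil_Integration.integral_combine) (use that h integrable_on_subinterval[OF h, of a t] in auto)
      show "\<exists>d>0. \<forall>y. norm (y - x) < d \<longrightarrow>
          norm (integral {a..y} h - integral {a..x} h - (y - x) *\<^sub>R h x) \<le> e * norm (y - x)"
      proof (intro exI[of _ "min (min d1 d2) (min (x - a) (b - x))"] conjI allI impI)
        show "0 < min (min d1 d2) (min (x - a) (b - x))" using d1 d2 x by simp
        fix y assume y: "norm (y - x) < min (min d1 d2) (min (x - a) (b - x))"
        then have yab: "a \<le> y" "y \<le> b" by (auto simp: abs_real_def split: if_splits)
        consider "x < y" | "x = y" | "y < x" by linarith
        then show "norm (integral {a..y} h - integral {a..x} h - (y - x) *\<^sub>R h x) \<le> e * norm (y - x)"
        proof cases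
          case 1
          then have "integral {x..y} h0 = integral {a..y} h - integral {a..x} h"
            using comb[of x y] eqi[of x y] x yab by (simp add: algebra_simps)
          then show ?thesis using d1(2)[of y] 1 y hx by simp
        next
          case 3
          have "integral {- x..- y} (\<lambda>x. h0 (- x)) = integral {y..x} h0" by simp
          also have "\<dots> = integral {a..x} h - integral {a..y} h"
            using comb[of y x] eqi[of y x] x yab 3 by (simp add: algebra_simps)
          finally have "norm (integral {a..x} h - integral {a..y} h - (x - y) *\<^sub>R h x) \<le> e * (x - y)"
            using d2(2)[of "- y"] 3 y hx by simp
          moreover have "integral {a..x} h - integral {a..y} h - (x - y) *\<^sub>R h x
             = - (integral {a..y} h - integral {a..x} h - (y - x) *\<^sub>R h x)"
            by (simp add: algebra_simps)
          ultimately show ?thesis using 3 by (simp only: norm_minus_cancel) simp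
        qed simp
      qed
    qed (simp add: bounded_linear_scaleR_left)
  qed
qed

text \<open>The density is that of the image of Lebesgue measure under the inverse of F; Lipschitz
  continuity of F makes this image absolutely continuous.\<close>
lemma bilipschitz_real_density:
  fixes F :: "real \<Rightarrow> real"
  assumes m: "m > 0" and low: "\<And>x y. x \<le> y \<Longrightarrow> m * (y - x) \<le> F y - F x"
    and up: "\<And>x y. x \<le> y \<Longrightarrow> F y - F x \<le> M * (y - x)"
  shows "\<exists>f\<in>borel_measurable lborel. \<forall>a b. a \<le> b \<longrightarrow> (\<integral>\<^sup>+x\<in>{a..b}. f x \<partial>lborel) = ennreal (F b - F a)"
proof -
  have mono: "F x < F y" if "x < y" for x y
  proof -
    have "0 < m * (y - x)" using m that by simp
    then show ?thesis using low[of x y] that by linarith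
  qed
  have less: "F x < F y \<longleftrightarrow> x < y" for x y
    using mono by (metis less_asym linorder_less_linear)
  have le: "F x \<le> F y \<longleftrightarrow> x \<le> y" for x y
    using less linorder_not_less by metis
  have M: "M \<ge> 0"
    using low[of 0 1] up[of 0 1] m by simp
  have absF: "\<bar>F y - F x\<bar> \<le> M * \<bar>y - x\<bar>" for x y
    using up[of x y] up[of y x] le[of x y] le[of y x] by (cases "x \<le> y") auto
  have lip: "M-lipschitz_on UNIV F"
    by (rule lipschitz_onI) (use absF M in \<open>auto simp: dist_real_def abs_minus_commute\<close>)
  have cont: "continuous_on UNIV F"
    using lip lipschitz_on_continuous_on by blast
  have surj: "\<exists>x. F x = z" for z
  proof -
    \<comment> \<open>At distance \<open>r\<close> from 0 the lower slope bound \<open>m\<close> has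
      carried \<open>F\<close> from \<open>F 0\<close> past \<open>z\<close> on the appropriate
      side; the intermediate value theorem then gives surjectivity.\<close>
    define r where "r = \<bar>z - F 0\<bar> / m"
    have r: "r \<ge> 0" "m * r = \<bar>z - F 0\<bar>" using m by (auto simp: r_def)
    have "F (- r) \<le> z" "z \<le> F r"
      using low[of "- r" 0] low[of 0 r] r by auto
    then show ?thesis
      using IVT'[of F "- r" z r] continuous_on_subset[OF cont] r by auto
  qed
  define G where "G = inv F"
  have FG: "F (G z) = z" for z
    unfolding G_def using surj by (metis f_inv_into_f rangeI)
  have GF: "G (F x) = x" for x
    using FG[of "F x"] less by (metis less_irrefl linorder_neqE)
  have "mono G"
    using le FG by (metis monoI)
  then have Gm: "G \<in> borel_measurable borel" by (rule borel_measurable_mono)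
  define \<nu> where "\<nu> = distr lborel lborel G"
  have vimage: "G -` A = F ` A" for A
    by (rule set_eqI) (metis FG GF image_iff vimage_eq)
  have \<nu>: "emeasure \<nu> A = emeasure lborel (F ` A)" if "A \<in> sets borel" for A
    unfolding \<nu>_def using that Gm by (subst emeasure_distr) (auto simp: vimage)
  have "absolutely_continuous lborel \<nu>"
    unfolding absolutely_continuous_def
  proof
    fix A assume A: "A \<in> null_sets (lborel :: real measure)"
    then have "negligible A"
      by (simp add: negligible_iff_null_sets null_sets_completionI)
    then have "negligible (F ` A)"
    proof (rule negligible_locally_Lipschitz_image[rotated])
      fix x assume "x \<in> A"
      show "\<exists>T B. open T \<and> x \<in> T \<and> (\<forall>y\<in>A \<inter> T. norm (F y - F x) \<le> B * norm (y - x))"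
        using absF by (intro exI[of _ UNIV] exI[of _ M]) auto
    qed simp
    \<comment> \<open>\<open>negligible\<close> speaks of the completed measure. The image is a
      Borel set, being the preimage of \<open>A\<close> under the monotone \<open>G\<close>, hence
      null for \<open>lborel\<close> itself.\<close>
    moreover have FA: "F ` A \<in> sets borel"
      using A measurable_sets_borel[OF Gm, of A] vimage by auto
    ultimately have "F ` A \<in> null_sets lborel"
      using null_sets_completion_iff[of "F ` A" lborel] negligible_iff_null_sets by auto
    then have "emeasure lborel (F ` A) = 0" by (rule null_setsD1)
    then show "A \<in> null_sets \<nu>"
      using A \<nu> by (auto simp: null_sets_def \<nu>_def)
  qed
  then obtain f where f: "f \<in> borel_measurable lborel" "density lborel f = \<nu>"
    using sigma_finite_measure.Radon_Nikodym[OF sigma_finite_lborel, of \<nu>] by (auto simp: \<nu>_def)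
  have "(\<integral>\<^sup>+x\<in>{a..b}. f x \<partial>lborel) = ennreal (F b - F a)" if "a \<le> b" for a b
  proof -
    have img: "F ` {a..b} = {F a..F b}"
    proof (intro equalityI subsetI)
      fix z assume "z \<in> {F a..F b}"
      then have "G z \<in> {a..b}" using le FG by (metis atLeastAtMost_iff)
      then show "z \<in> F ` {a..b}" using FG by (metis image_eqI)
    qed (use le in auto)
    have "(\<integral>\<^sup>+x\<in>{a..b}. f x \<partial>lborel) = emeasure \<nu> {a..b}"
      using f emeasure_density[of f lborel "{a..b}"] by simp
    also have "\<dots> = ennreal (F b - F a)"
      using that le[of a b] by (simp add: \<nu> img)
    finally show ?thesis .
  qed
  then show ?thesis using f(1) by blast
qed

lemma has_field_derivative_bounds:
  fixes H :: "real \<Rightarrow> real"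
  assumes "(H has_field_derivative D) (at x)" "x \<in> {a<..<b}"
    and H: "\<And>s t. \<lbrakk>a \<le> s; s \<le> t; t \<le> b\<rbrakk> \<Longrightarrow> m * (t - s) \<le> H t - H s \<and> H t - H s \<le> M * (t - s)"
  shows "m \<le> D" "D \<le> M"
proof -
  have lim: "((\<lambda>h. (H (x + h) - H x) / h) \<longlongrightarrow> D) (at 0)"
    using assms(1) by (simp add: DERIV_def)
  have ev: "\<forall>\<^sub>F h in at 0. m \<le> (H (x + h) - H x) / h \<and> (H (x + h) - H x) / h \<le> M"
    unfolding eventually_at
  proof (intro exI[of _ "min (x - a) (b - x)"] conjI ballI impI)
    fix h :: real assume h: "h \<noteq> 0 \<and> dist h 0 < min (x - a) (b - x)"
    then have "a \<le> x + h" "x + h \<le> b" by auto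
    then have "m \<le> (H (x + h) - H x) / h \<and> (H (x + h) - H x) / h \<le> M"
      using H[of x "x + h"] H[of "x + h" x] h assms(2)
      by (cases "h > 0") (auto simp: field_simps)
    then show "m \<le> (H (x + h) - H x) / h" "(H (x + h) - H x) / h \<le> M" by auto
  qed (use assms(2) in auto)
  show "m \<le> D" by (rule tendsto_lowerbound[OF lim]) (use ev in \<open>auto elim: eventually_mono\<close>)
  show "D \<le> M" by (rule tendsto_upperbound[OF lim]) (use ev in \<open>auto elim: eventually_mono\<close>)
qed

text \<open>The density lemma needs slope bounds on the whole line, so \<open>F\<close> is first
  extended. The density is determined only up to null sets; its bounds come from differentiating its
  indefinite integral, whose difference quotients lie between \<open>m\<close> and
  \<open>M\<close>.\<close>

lemma bilipschitz_real_integral: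
  fixes F :: "real \<Rightarrow> real"
  assumes "a < b" and m: "m > 0"
    and F: "\<And>s t. \<lbrakk>a \<le> s; s \<le> t; t \<le> b\<rbrakk> \<Longrightarrow> m * (t - s) \<le> F t - F s \<and> F t - F s \<le> M * (t - s)"
  shows "\<exists>f\<in>borel_measurable borel. (\<forall>x. m \<le> f x \<and> f x \<le> M) \<and>
           (\<forall>s t. a \<le> s \<and> s \<le> t \<and> t \<le> b \<longrightarrow> (f has_integral F t - F s) {s..t})"
proof -
  have "m * (b - a) \<le> M * (b - a)" using F[of a b] \<open>a < b\<close> by linarith
  then have mM: "m \<le> M" using \<open>a < b\<close> by (simp add: mult_le_cancel_right)
  define p where "p x = max a (min b x)" for x
  \<comment> \<open>Here \<open>p\<close> projects onto \<open>{a..b}\<close>, and \<open>G\<close>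
    continues \<open>F\<close> with slope \<open>m\<close> on both sides. Both slope bounds persist
    because \<open>m \<le> M\<close>.\<close>
  define G where "G x = F (p x) + m * (x - p x)" for x
  have G: "m * (y - x) \<le> G y - G x \<and> G y - G x \<le> M * (y - x)" if "x \<le> y" for x y
  proof -
    have p: "a \<le> p x" "p x \<le> p y" "p y \<le> b" "p y - p x \<le> y - x"
      using that \<open>a < b\<close> by (auto simp: p_def)
    have "m * ((y - x) - (p y - p x)) \<le> M * ((y - x) - (p y - p x))"
      using p mM by (intro mult_right_mono) auto
    then show ?thesis using F[OF p(1-3)] by (auto simp: G_def algebra_simps)
  qed
  have GF: "G x = F x" if "a \<le> x" "x \<le> b" for x
    using that by (simp add: G_def p_def)
  obtain f where f[measurable]: "f \<in> borel_measurable lborel"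
    and fG: "\<And>s t. s \<le> t \<Longrightarrow> (\<integral>\<^sup>+x\<in>{s..t}. f x \<partial>lborel) = ennreal (G t - G s)"
    using bilipschitz_real_density[of m G M] G m by blast
  \<comment> \<open>\<open>enn2real\<close> sends infinity to 0. On \<open>{a..b}\<close> this
    alters \<open>f\<close> only on a null set, since the integral of \<open>f\<close> there is
    finite.\<close>
  define g where "g x = enn2real (f x)" for x
  have gm[measurable]: "g \<in> borel_measurable borel"
    using f unfolding g_def by measurable
  have g: "(g has_integral F t - F s) {s..t}" if st: "a \<le> s" "s \<le> t" "t \<le> b" for s t
  proof -
    have FF: "(\<integral>\<^sup>+x. f x * indicator {s..t} x \<partial>lborel) = ennreal (F t - F s)"
      using fG[OF st(2)] GF st by simp
    then have "AE x in lborel. f x * indicator {s..t} x \<noteq> \<infinity>"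
      by (intro nn_integral_PInf_AE) auto
    then have "AE x in lborel. ennreal (g x * indicator {s..t} x) = f x * indicator {s..t} x"
      by eventually_elim (auto simp: g_def indicator_def less_top)
    then have "(\<integral>\<^sup>+x. ennreal (g x * indicator {s..t} x) \<partial>lborel) = ennreal (F t - F s)"
      using FF nn_integral_cong_AE by fastforce
    moreover have "0 \<le> F t - F s" using F[OF st] m st by (smt (verit) mult_nonneg_nonneg)
    ultimately have "((\<lambda>x. g x * indicator {s..t} x) has_integral F t - F s) UNIV"
      by (intro nn_integral_has_integral) (auto simp: g_def indicator_def)
    moreover have "(\<lambda>x. g x * indicator {s..t} x) = (\<lambda>x. if x \<in> {s..t} then g x else 0)"
      by auto
    ultimately show ?thesis by (simp only: has_integral_restrict_UNIV)
  qed
  obtain N where N: "negligible N"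
    "\<And>x. x \<in> {a<..<b} - N \<Longrightarrow> ((\<lambda>s. integral {a..s} g) has_vector_derivative g x) (at x)"
    using integral_has_vector_derivative_ae[of g a b] g[of a b] \<open>a < b\<close> by (auto simp: integrable_on_def)
  have int: "integral {a..s} g = F s - F a" if "a \<le> s" "s \<le> b" for s
    using g[of a s] that by (simp add: integral_unique)
  have gb: "m \<le> g x \<and> g x \<le> M" if "x \<in> {a<..<b} - N" for x
    using has_field_derivative_bounds[of "\<lambda>s. integral {a..s} g" "g x" x a b m M] N(2)[OF that] that F
    by (auto simp: int has_real_derivative_iff_has_vector_derivative)
  \<comment> \<open>The bounds on \<open>g\<close> are known only off a null set of the open
    interval. Clamping enforces them at every point and leaves all integrals within
    \<open>{a..b}\<close> unchanged.\<close>
  define h where "h x = max m (min M (g x))" for x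
  have "(h has_integral F t - F s) {s..t}" if st: "a \<le> s" "s \<le> t" "t \<le> b" for s t
  proof (rule has_integral_spike[OF _ _ g[OF st]])
    show "negligible (N \<union> {a, b})" using N by simp
    show "h x = g x" if "x \<in> {s..t} - (N \<union> {a, b})" for x
      using gb[of x] that st by (auto simp: h_def)
  qed
  moreover have "h \<in> borel_measurable borel" unfolding h_def by measurable
  moreover have "m \<le> h x \<and> h x \<le> M" for x using mM by (auto simp: h_def)
  ultimately show ?thesis by blast
qed

section \<open>Primitives and integration by parts\<close>

lemma has_integral_imp_lipschitz_on:
  fixes f :: "real \<Rightarrow> 'a::banach"
  assumes "\<And>s t. \<lbrakk>a \<le> s; s \<le> t; t \<le> b\<rbrakk> \<Longrightarrow> (g has_integral f t - f s) {s..t}"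
    and "\<And>x. x \<in> {a..b} \<Longrightarrow> norm (g x) \<le> C" and "C \<ge> 0"
  shows "C-lipschitz_on {a..b} f"
proof (rule lipschitz_on_leI)
  fix s t assume st: "s \<in> {a..b}" "t \<in> {a..b}" "s \<le> t"
  have "norm (f t - f s) \<le> C * measure lborel (cbox s t)"
    by (rule has_integral_bound[OF \<open>C \<ge> 0\<close>]) (use st assms in auto)
  then show "dist (f s) (f t) \<le> C * dist s t"
    using st by (simp add: dist_norm norm_minus_commute)
qed fact

lemma lipschitz_on_mult:
  fixes f g :: "'a::metric_space \<Rightarrow> 'b::real_normed_algebra"
  assumes f: "K-lipschitz_on X f" and g: "L-lipschitz_on X g"
    and "\<And>x. x \<in> X \<Longrightarrow> norm (f x) \<le> A" "\<And>x. x \<in> X \<Longrightarrow> norm (g x) \<le> B"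
    and "A \<ge> 0" "B \<ge> 0"
  shows "(A * L + K * B)-lipschitz_on X (\<lambda>x. f x * g x)"
proof (rule lipschitz_onI)
  have KL: "K \<ge> 0" "L \<ge> 0" using f g lipschitz_on_nonneg by blast+
  then show "0 \<le> A * L + K * B" using assms(5,6) by simp
  fix x y assume xy: "x \<in> X" "y \<in> X"
  have "f x * g x - f y * g y = f x * (g x - g y) + (f x - f y) * g y"
    by (simp add: algebra_simps)
  then have "norm (f x * g x - f y * g y) \<le> norm (f x * (g x - g y)) + norm ((f x - f y) * g y)"
    by (simp add: norm_triangle_ineq)
  also have "\<dots> \<le> norm (f x) * norm (g x - g y) + norm (f x - f y) * norm (g y)"
    by (intro add_mono norm_mult_ineq)
  also have "\<dots> \<le> A * (L * dist x y) + (K * dist x y) * B"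
    using lipschitz_onD[OF f xy] lipschitz_onD[OF g xy] assms xy KL
    by (intro add_mono mult_mono) (auto simp: dist_norm)
  finally show "dist (f x * g x) (f y * g y) \<le> (A * L + K * B) * dist x y"
    by (simp add: dist_norm algebra_simps)
qed

lemma lipschitz_on_mult_interval:
  fixes f g :: "real \<Rightarrow> 'b::real_normed_algebra"
  assumes f: "K-lipschitz_on {a..b} f" and g: "L-lipschitz_on {a..b} g"
  shows "\<exists>M. M-lipschitz_on {a..b} (\<lambda>x. f x * g x)"
proof -
  have bdd: "\<exists>B\<ge>0. \<forall>x\<in>{a..b}. norm (h x) \<le> B" if "C-lipschitz_on {a..b} h" for h :: "real \<Rightarrow> 'b" and C
  proof -
    have "bounded (h ` {a..b})"
      using that compact_continuous_image[OF lipschitz_on_continuous_on] compact_Icc compact_imp_bounded by blast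
    then show ?thesis by (auto simp: bounded_pos) (meson less_imp_le)
  qed
  obtain A B where "A \<ge> 0" "\<forall>x\<in>{a..b}. norm (f x) \<le> A" "B \<ge> 0" "\<forall>x\<in>{a..b}. norm (g x) \<le> B"
    using bdd[OF f] bdd[OF g] by blast
  then show ?thesis using lipschitz_on_mult[OF f g, of A B] by blast
qed

text \<open>A product of Lipschitz functions on a compact interval is Lipschitz, hence absolutely
  continuous, so the product rule almost everywhere already determines the increment.\<close>

lemma has_integral_product_derivative:
  fixes f g :: "real \<Rightarrow> 'b::{real_normed_algebra, banach}"
  assumes "a \<le> b" and f: "K-lipschitz_on {a..b} f" and g: "L-lipschitz_on {a..b} g"
    and N: "negligible N"
    and df: "\<And>x. x \<in> {a<..<b} - N \<Longrightarrow> (f has_vector_derivative f' x) (at x)"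
    and dg: "\<And>x. x \<in> {a<..<b} - N \<Longrightarrow> (g has_vector_derivative g' x) (at x)"
  shows "((\<lambda>x. f x * g' x + f' x * g x) has_integral f b * g b - f a * g a) {a..b}"
proof -
  obtain M where M: "M-lipschitz_on {a..b} (\<lambda>x. f x * g x)"
    using lipschitz_on_mult_interval[OF f g] by blast
  show ?thesis
  proof (rule has_integral_abs_continuous[OF \<open>a \<le> b\<close> lipschitz_on_imp_abs_continuous[OF M]])
    show "negligible (N \<union> {a, b})" using N by simp
    fix x assume "x \<in> {a..b} - (N \<union> {a, b})"
    then have "x \<in> {a<..<b} - N" by auto
    from has_vector_derivative_mult[OF df[OF this] dg[OF this]]
    show "((\<lambda>x. f x * g x) has_vector_derivative f x * g' x + f' x * g x) (at x within {a..b})"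
      by (rule has_vector_derivative_at_within)
  qed
qed

lemma negligible_imp_AE_lebesgue_on:
  assumes "negligible N" "\<And>x. x \<in> S - N \<Longrightarrow> P x" "S \<in> sets lebesgue"
  shows "AE x in lebesgue_on S. P x"
proof -
  have "AE x in lebesgue. x \<in> S \<longrightarrow> P x"
    using assms by (intro AE_I'[of N]) (auto simp: negligible_iff_null_sets)
  then show ?thesis using assms(3) by (subst AE_restrict_space_iff) auto
qed

lemma AE_lebesgue_on_imp_negligible:
  assumes "AE x in lebesgue_on S. P x" "S \<in> sets lebesgue"
  shows "\<exists>N. negligible N \<and> (\<forall>x\<in>S - N. P x)"
proof -
  have "AE x in lebesgue. x \<in> S \<longrightarrow> P x"
    using assms by (subst (asm) AE_restrict_space_iff) auto
  then obtain N where "N \<in> null_sets lebesgue" "{x \<in> space lebesgue. \<not> (x \<in> S \<longrightarrow> P x)} \<subseteq> N"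
    unfolding eventually_ae_filter by blast
  then show ?thesis by (intro exI[of _ N]) (auto simp: negligible_iff_null_sets)
qed

lemma primitive_has_vector_derivative_ae:
  fixes f :: "real \<Rightarrow> 'a::euclidean_space"
  assumes "a \<le> b" and f: "\<And>s t. \<lbrakk>a \<le> s; s \<le> t; t \<le> b\<rbrakk> \<Longrightarrow> (g has_integral f t - f s) {s..t}"
  shows "\<exists>N. negligible N \<and> (\<forall>x\<in>{a<..<b} - N. (f has_vector_derivative g x) (at x))"
proof -
  have "g integrable_on {a..b}" using f[of a b] \<open>a \<le> b\<close> by blast
  then obtain N where N: "negligible N"
    "\<And>x. x \<in> {a<..<b} - N \<Longrightarrow> ((\<lambda>s. integral {a..s} g) has_vector_derivative g x) (at x)"
    using integral_has_vector_derivative_ae by blast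
  have "(f has_vector_derivative g x) (at x)" if x: "x \<in> {a<..<b} - N" for x
  proof (rule has_vector_derivative_transform_within_open[of "\<lambda>s. f a + integral {a..s} g" _ _ "{a<..<b}"])
    show "((\<lambda>s. f a + integral {a..s} g) has_vector_derivative g x) (at x)"
      using has_vector_derivative_add[OF has_vector_derivative_const N(2)[OF x]] by simp
    show "f a + integral {a..s} g = f s" if "s \<in> {a<..<b}" for s
      using f[of a s] that by (simp add: integral_unique)
  qed (use x in auto)
  then show ?thesis using N(1) by blast
qed

text \<open>The representative \<open>\<epsilon>\<close> may violate its bounds on a null set and
  behave arbitrarily outside the interval. Truncation to the range from \<open>m\<close> to
  \<open>M\<close> agrees with it almost everywhere on the interval, and boundedness then yields
  integrability.\<close>

lemma admissible_cavity_primitive: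
  assumes "l > 0" "admissible_cavity l m M \<epsilon>" "0 \<le> m" "m \<le> M"
  shows "\<exists>f F N. negligible N \<and> (\<forall>x\<in>{0<..<l} - N. f x = \<epsilon> x) \<and>
    (\<forall>x. m \<le> f x \<and> f x \<le> M) \<and> F 0 = 0 \<and>
    (\<forall>s t. 0 \<le> s \<longrightarrow> s \<le> t \<longrightarrow> t \<le> l \<longrightarrow> (f has_integral F t - F s) {s..t})"
proof -
  have meas: "\<epsilon> \<in> borel_measurable (lebesgue_on {0<..<l})"
    and AE: "AE s in lebesgue_on {0<..<l}. m \<le> \<epsilon> s \<and> \<epsilon> s \<le> M"
    using assms by (auto simp: admissible_cavity_def)
  obtain N where N: "negligible N" "\<forall>x\<in>{0<..<l} - N. m \<le> \<epsilon> x \<and> \<epsilon> x \<le> M"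
    using AE_lebesgue_on_imp_negligible[OF AE] by auto
  define f where "f x = max m (min M (\<epsilon> x))" for x
  have "f \<in> borel_measurable (lebesgue_on {0<..<l})"
    unfolding f_def using meas by measurable
  then have "f integrable_on {0<..<l}"
    using assms by (intro measurable_bounded_by_integrable_imp_integrable[of f _ "\<lambda>_. M"])
      (auto simp: f_def integrable_on_open_interval_real)
  then have int: "f integrable_on {0..l}" by (simp add: integrable_on_open_interval_real)
  define F where "F s = integral {0..s} f" for s
  have "(f has_integral F t - F s) {s..t}" if st: "0 \<le> s" "s \<le> t" "t \<le> l" for s t
  proof -
    have "f integrable_on {0..t}" "f integrable_on {s..t}"
      using integrable_subinterval_real[OF int] st by auto
    then show ?thesis
      using Henstock_Kurzweil_Integration.integral_combine[of 0 s t f] st unfolding F_def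
      by (metis add_diff_cancel_left' integrable_integral)
  qed
  then show ?thesis using N assms(4)
    by (intro exI[of _ f] exI[of _ F] exI[of _ N]) (auto simp: f_def F_def)
qed

text \<open>Integration by parts for Lipschitz functions. The value of the integral mentions only
  \<open>F\<close>, \<open>E\<close> and \<open>E1\<close>; the density \<open>f\<close> has
  disappeared from it.\<close>

lemma has_integral_mult_primitive:
  fixes f F :: "real \<Rightarrow> real" and E E1 :: "real \<Rightarrow> complex"
  assumes "a \<le> b" and f: "\<And>s t. \<lbrakk>a \<le> s; s \<le> t; t \<le> b\<rbrakk> \<Longrightarrow> (f has_integral F t - F s) {s..t}"
    and fC: "\<And>x. x \<in> {a..b} \<Longrightarrow> \<bar>f x\<bar> \<le> C"
    and E: "\<And>s t. \<lbrakk>a \<le> s; s \<le> t; t \<le> b\<rbrakk> \<Longrightarrow> (E1 has_integral E t - E s) {s..t}"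
    and E1: "continuous_on {a..b} E1"
  shows "((\<lambda>x. of_real (f x) * E x) has_integral
     of_real (F b) * E b - of_real (F a) * E a - integral {a..b} (\<lambda>x. of_real (F x) * E1 x)) {a..b}"
proof -
  define F' f' where "F' x = complex_of_real (F x)" and "f' x = complex_of_real (f x)" for x
  have C: "C \<ge> 0" using fC[of a] \<open>a \<le> b\<close> by auto
  have f': "(f' has_integral F' t - F' s) {s..t}" if "a \<le> s" "s \<le> t" "t \<le> b" for s t
    using has_integral_linear[OF f[OF that] bounded_linear_of_real]
    by (simp add: F'_def f'_def[abs_def] o_def)
  have F'lip: "C-lipschitz_on {a..b} F'"
    by (rule has_integral_imp_lipschitz_on[OF f']) (use fC C in \<open>auto simp: f'_def\<close>)
  have "bounded (E1 ` {a..b})"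
    using E1 compact_continuous_image compact_Icc compact_imp_bounded by blast
  then obtain B where B: "B > 0" "\<forall>x\<in>{a..b}. norm (E1 x) \<le> B"
    by (auto simp: bounded_pos)
  have Elip: "B-lipschitz_on {a..b} E"
    by (rule has_integral_imp_lipschitz_on[OF E]) (use B in auto)
  obtain N1 where N1: "negligible N1" "\<forall>x\<in>{a<..<b} - N1. (F' has_vector_derivative f' x) (at x)"
    using primitive_has_vector_derivative_ae[OF \<open>a \<le> b\<close> f'] by blast
  obtain N2 where N2: "negligible N2" "\<forall>x\<in>{a<..<b} - N2. (E has_vector_derivative E1 x) (at x)"
    using primitive_has_vector_derivative_ae[OF \<open>a \<le> b\<close> E] by blast
  have 1: "((\<lambda>x. F' x * E1 x + f' x * E x) has_integral F' b * E b - F' a * E a) {a..b}"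
    by (rule has_integral_product_derivative[OF \<open>a \<le> b\<close> F'lip Elip, of "N1 \<union> N2"])
      (use N1 N2 in auto)
  have "(\<lambda>x. F' x * E1 x) integrable_on {a..b}"
    using E1 lipschitz_on_continuous_on[OF F'lip]
    by (intro integrable_continuous_real continuous_intros)
  from has_integral_diff[OF 1 integrable_integral[OF this]]
  show ?thesis by (simp add: F'_def f'_def)
qed

section \<open>Quasi-normal eigenvalues\<close>

text \<open>Absolute continuity of \<open>E1\<close> turns the almost-everywhere equation into an
  integral identity on every subinterval. The integrand is bounded, so \<open>E1\<close> is
  Lipschitz and in particular continuous.\<close>

lemma qn_solution_integral_form:
  assumes "l > 0" "admissible_cavity l m M \<epsilon>" "0 \<le> m" "m \<le> M" "qn_solution l c q \<epsilon> \<omega> E"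
  shows "\<exists>f F E1. (\<forall>x. m \<le> f x \<and> f x \<le> M) \<and> F 0 = 0 \<and>
    (\<forall>s t. 0 \<le> s \<longrightarrow> s \<le> t \<longrightarrow> t \<le> l \<longrightarrow> (f has_integral F t - F s) {s..t}) \<and>
    continuous_on {0..l} E1 \<and>
    (\<forall>s t. 0 \<le> s \<longrightarrow> s \<le> t \<longrightarrow> t \<le> l \<longrightarrow> (E1 has_integral E t - E s) {s..t}) \<and>
    (\<forall>s t. 0 \<le> s \<longrightarrow> s \<le> t \<longrightarrow> t \<le> l \<longrightarrow>
      ((\<lambda>x. - (\<omega>\<^sup>2 / (complex_of_real c)\<^sup>2) * of_real (f x) * E x) has_integral E1 t - E1 s) {s..t}) \<and>
    E 0 = 0 \<and> \<i> * \<omega> * complex_of_real (sqrt q / c) * E l = E1 l"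
proof -
  obtain E1 where ac: "abs_continuous_on_interval 0 l E1"
    and E: "\<forall>s\<in>{0..l}. (E has_vector_derivative E1 s) (at s within {0..l})"
    and AE: "AE s in lebesgue_on {0<..<l}. (E1 has_vector_derivative
                 - (\<omega>\<^sup>2 / (complex_of_real c)\<^sup>2) * complex_of_real (\<epsilon> s) * E s) (at s)"
    and bc: "E 0 = 0" "\<i> * \<omega> * complex_of_real (sqrt q / c) * E l = E1 l"
    using assms(5) unfolding qn_solution_def by auto
  obtain f F N1 where N1: "negligible N1" "\<forall>x\<in>{0<..<l} - N1. f x = \<epsilon> x"
    and f: "\<forall>x. m \<le> f x \<and> f x \<le> M" "F 0 = 0"
     "\<forall>s t. 0 \<le> s \<longrightarrow> s \<le> t \<longrightarrow> t \<le> l \<longrightarrow> (f has_integral F t - F s) {s..t}"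
    using admissible_cavity_primitive[OF assms(1-4)] by auto
  obtain N2 where N2: "negligible N2" "\<forall>s\<in>{0<..<l} - N2. (E1 has_vector_derivative
                 - (\<omega>\<^sup>2 / (complex_of_real c)\<^sup>2) * complex_of_real (\<epsilon> s) * E s) (at s)"
    using AE_lebesgue_on_imp_negligible[OF AE] by auto
  define g where "g x = - (\<omega>\<^sup>2 / (complex_of_real c)\<^sup>2) * of_real (f x) * E x" for x
  have gi: "(g has_integral E1 t - E1 s) {s..t}" if st: "0 \<le> s" "s \<le> t" "t \<le> l" for s t
  proof (rule has_integral_abs_continuous[OF st(2) abs_continuous_on_interval_subset[OF ac st(1,3)]])
    show "negligible (N1 \<union> N2 \<union> {0, l})" using N1 N2 by simp
    fix x assume "x \<in> {s..t} - (N1 \<union> N2 \<union> {0, l})"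
    then have x: "x \<in> {0<..<l} - N1" "x \<in> {0<..<l} - N2" using st by auto
    show "(E1 has_vector_derivative g x) (at x within {s..t})"
      unfolding g_def bspec[OF N1(2) x(1)]
      by (rule has_vector_derivative_at_within[OF bspec[OF N2(2) x(2)]])
  qed
  have Ei: "(E1 has_integral E t - E s) {s..t}" if st: "0 \<le> s" "s \<le> t" "t \<le> l" for s t
  proof (rule fundamental_theorem_of_calculus[OF st(2)])
    fix x assume "x \<in> {s..t}"
    then have x: "x \<in> {0..l}" and sub: "{s..t} \<subseteq> {0..l}" using st by auto
    show "(E has_vector_derivative E1 x) (at x within {s..t})"
      by (rule has_vector_derivative_within_subset[OF bspec[OF E x] sub])
  qed
  have "continuous_on {0..l} E"
    unfolding continuous_on_eq_continuous_within using E has_vector_derivative_continuous by blast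
  then have "bounded (E ` {0..l})"
    using compact_continuous_image compact_Icc compact_imp_bounded by blast
  then obtain B where B: "B > 0" "\<forall>x\<in>{0..l}. norm (E x) \<le> B"
    by (auto simp: bounded_pos)
  have "(norm (\<omega>\<^sup>2 / (complex_of_real c)\<^sup>2) * M * B)-lipschitz_on {0..l} E1"
  proof (rule has_integral_imp_lipschitz_on[OF gi])
    show "0 \<le> norm (\<omega>\<^sup>2 / (complex_of_real c)\<^sup>2) * M * B"
      using assms B by simp
    have "\<bar>f x\<bar> \<le> M" for x using f(1) assms(3) by (metis abs_of_nonneg order_trans)
    then show "norm (g x) \<le> norm (\<omega>\<^sup>2 / (complex_of_real c)\<^sup>2) * M * B" if "x \<in> {0..l}" for x
      using that B(2) assms(3,4) unfolding g_def norm_mult norm_minus_cancel norm_of_real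
      by (intro mult_mono mult_nonneg_nonneg) auto
  qed
  then have "continuous_on {0..l} E1" by (rule lipschitz_on_continuous_on)
  then show ?thesis
    using f gi Ei bc unfolding g_def by (intro exI[of _ f] exI[of _ F] exI[of _ E1]) simp
qed

text \<open>If the imaginary part were positive, integrating the derivative of the flux W over
  \<open>{0..l}\<close> would force the integral of |E'|^2 to vanish. Then \<open>E\<close> is
  constant, equal to \<open>E 0 = 0\<close>, which contradicts nontriviality.\<close>

lemma qn_eigenvalue_Im_le_0:
  assumes "l > 0" "c > 0" "q \<ge> 0" "admissible_cavity l m M \<epsilon>" "0 \<le> m" "m \<le> M"
    and ev: "qn_eigenvalue l c q \<epsilon> \<omega>"
  shows "Im \<omega> \<le> 0"
proof (rule ccontr)
  assume "\<not> Im \<omega> \<le> 0"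
  then have y: "Im \<omega> > 0" by simp
  obtain E s0 where sol: "qn_solution l c q \<epsilon> \<omega> E" and s0: "s0 \<in> {0..l}" "E s0 \<noteq> 0"
    using ev unfolding qn_eigenvalue_def by auto
  obtain f F E1 where f: "\<forall>x. m \<le> f x \<and> f x \<le> M"
    and E1: "continuous_on {0..l} E1"
    and Ei: "\<And>s t. \<lbrakk>0 \<le> s; s \<le> t; t \<le> l\<rbrakk> \<Longrightarrow> (E1 has_integral E t - E s) {s..t}"
    and gi: "\<And>s t. \<lbrakk>0 \<le> s; s \<le> t; t \<le> l\<rbrakk> \<Longrightarrow>
      ((\<lambda>x. - (\<omega>\<^sup>2 / (complex_of_real c)\<^sup>2) * of_real (f x) * E x) has_integral E1 t - E1 s) {s..t}"
    and bc: "E 0 = 0" "\<i> * \<omega> * complex_of_real (sqrt q / c) * E l = E1 l"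
    using qn_solution_integral_form[OF assms(1,4-6) sol] by auto
  define g where "g x = - (\<omega>\<^sup>2 / (complex_of_real c)\<^sup>2) * of_real (f x) * E x" for x
  \<comment> \<open>The flux is \<open>Re (E1 * D)\<close>. With the factor
    \<open>\<i> * \<omega>\<close> inside the conjugate, the outgoing condition turns
    \<open>E1 l * D l\<close> into a nonnegative multiple of a squared norm.\<close>
  define D D1 where "D s = cnj (\<i> * \<omega> * E s)" and "D1 s = cnj (\<i> * \<omega> * E1 s)" for s
  have Di: "(D1 has_integral D t - D s) {s..t}" if "0 \<le> s" "s \<le> t" "t \<le> l" for s t
  proof -
    have "bounded_linear (\<lambda>z. cnj (\<i> * \<omega> * z))"
      by (intro bounded_linear_compose[OF bounded_linear_cnj] bounded_linear_mult_right)
    from has_integral_linear[OF Ei[OF that] this]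
    show ?thesis by (simp add: D_def D1_def[abs_def] o_def algebra_simps)
  qed
  have bdd: "\<exists>B\<ge>0. \<forall>x\<in>{0..l}. norm (h x) \<le> B" if "continuous_on {0..l} h" for h :: "real \<Rightarrow> complex"
  proof -
    have "bounded (h ` {0..l})"
      using that compact_continuous_image compact_Icc compact_imp_bounded by blast
    then show ?thesis by (auto simp: bounded_pos) (meson less_imp_le)
  qed
  obtain B1 where B1: "B1 \<ge> 0" "\<forall>x\<in>{0..l}. norm (E1 x) \<le> B1" using bdd[OF E1] by blast
  have lipE: "B1-lipschitz_on {0..l} E"
    by (rule has_integral_imp_lipschitz_on[OF Ei]) (use B1 in auto)
  have D1: "continuous_on {0..l} D1" unfolding D1_def by (intro continuous_intros E1)
  obtain B2 where B2: "B2 \<ge> 0" "\<forall>x\<in>{0..l}. norm (D1 x) \<le> B2" using bdd[OF D1] by blast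
  have lipD: "B2-lipschitz_on {0..l} D"
    by (rule has_integral_imp_lipschitz_on[OF Di]) (use B2 in auto)
  obtain B where B: "B \<ge> 0" "\<forall>x\<in>{0..l}. norm (E x) \<le> B"
    using bdd lipschitz_on_continuous_on[OF lipE] by blast
  have lipE1: "(norm (\<omega>\<^sup>2 / (complex_of_real c)\<^sup>2) * M * B)-lipschitz_on {0..l} E1"
  proof (rule has_integral_imp_lipschitz_on[OF gi])
    show "0 \<le> norm (\<omega>\<^sup>2 / (complex_of_real c)\<^sup>2) * M * B"
      using assms B by simp
    have "\<bar>f x\<bar> \<le> M" for x using f(1) assms(5) by (metis abs_of_nonneg order_trans)
    then show "norm (- (\<omega>\<^sup>2 / (complex_of_real c)\<^sup>2) * complex_of_real (f x) * E x)
        \<le> norm (\<omega>\<^sup>2 / (complex_of_real c)\<^sup>2) * M * B" if "x \<in> {0..l}" for x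
      using that B(2) assms(5,6) unfolding norm_mult norm_minus_cancel norm_of_real
      by (intro mult_mono mult_nonneg_nonneg) auto
  qed
  have l0: "0 \<le> l" using assms(1) by simp
  obtain N1 where N1: "negligible N1" "\<forall>x\<in>{0<..<l} - N1. (E1 has_vector_derivative g x) (at x)"
    using primitive_has_vector_derivative_ae[OF l0 gi] unfolding g_def by blast
  obtain N2 where N2: "negligible N2" "\<forall>x\<in>{0<..<l} - N2. (D has_vector_derivative D1 x) (at x)"
    using primitive_has_vector_derivative_ae[OF l0 Di] by blast
  have "((\<lambda>x. E1 x * D1 x + g x * D x) has_integral E1 l * D l - E1 0 * D 0) {0..l}"
    by (rule has_integral_product_derivative[OF l0 lipE1 lipD, of "N1 \<union> N2"]) (use N1 N2 in auto)
  from has_integral_linear[OF this bounded_linear_Re]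
  have 1: "((\<lambda>x. Re (E1 x * D1 x + g x * D x)) has_integral Re (E1 l * D l)) {0..l}"
    using bc by (simp add: D_def o_def)
  have 2: "Re (E1 l * D l) = sqrt q / c * (norm (\<i> * \<omega> * E l))\<^sup>2"
  proof -
    have "E1 l * D l = of_real (sqrt q / c) * ((\<i> * \<omega> * E l) * cnj (\<i> * \<omega> * E l))"
      unfolding D_def bc(2)[symmetric] by (simp only: mult_ac)
    also have "\<dots> = of_real (sqrt q / c * (norm (\<i> * \<omega> * E l))\<^sup>2)"
      by (simp only: complex_norm_square of_real_mult)
    finally show ?thesis by simp
  qed
  \<comment> \<open>The left side is the derivative of the flux. The term containing
    \<open>f\<close> is kept only through its sign, so the bound is a multiple of the continuous
    function |E'|^2, whose vanishing can be read off from its integral.\<close>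
  have 3: "Re (E1 x * D1 x + g x * D x) \<le> - Im \<omega> * (norm (E1 x))\<^sup>2" for x
  proof -
    have "E1 x * D1 x = (- \<i> * cnj \<omega>) * (E1 x * cnj (E1 x))"
      by (simp add: D1_def mult_ac)
    also have "\<dots> = (- \<i> * cnj \<omega>) * of_real ((norm (E1 x))\<^sup>2)"
      by (simp only: complex_norm_square)
    finally have a: "Re (E1 x * D1 x) = - Im \<omega> * (norm (E1 x))\<^sup>2" by simp
    \<comment> \<open>One factor of \<omega>^2 pairs with the conjugate \<omega> from
      \<open>D x\<close>; the other stays in \<open>\<i> * \<omega>\<close>, whose real part is
      \<open>- Im \<omega>\<close>.\<close>
    have "g x * D x = (\<i> * \<omega>) * of_real (f x / c\<^sup>2) * (\<omega> * cnj \<omega>) * (E x * cnj (E x))"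
      by (simp add: g_def D_def power2_eq_square mult_ac)
    also have "\<dots> = (\<i> * \<omega>) * of_real (f x / c\<^sup>2 * (norm \<omega>)\<^sup>2 * (norm (E x))\<^sup>2)"
      by (simp only: complex_norm_square of_real_mult mult.assoc)
    finally have b: "Re (g x * D x) = - Im \<omega> * (f x / c\<^sup>2 * (norm \<omega>)\<^sup>2 * (norm (E x))\<^sup>2)" by simp
    have "0 \<le> f x" using f assms(5) order_trans by blast
    then have "Re (g x * D x) \<le> 0" unfolding b using y by simp
    then show ?thesis using a by simp
  qed
  have cont: "continuous_on {0..l} (\<lambda>x. (norm (E1 x))\<^sup>2)"
    by (intro continuous_intros E1)
  define J where "J = integral {0..l} (\<lambda>x. (norm (E1 x))\<^sup>2)"
  have "((\<lambda>x. - Im \<omega> * (norm (E1 x))\<^sup>2) has_integral - Im \<omega> * J) {0..l}"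
    unfolding J_def by (intro has_integral_mult_right integrable_integral integrable_continuous_real cont)
  from has_integral_le[OF 1 this] 3 have "Re (E1 l * D l) \<le> - Im \<omega> * J" by simp
  moreover have "0 \<le> Re (E1 l * D l)" unfolding 2 using assms(2,3) by simp
  ultimately have "J \<le> 0" using y by (smt (verit) mult_pos_pos mult_minus_left)
  moreover have "J \<ge> 0" unfolding J_def by (rule integral_nonneg[OF integrable_continuous_real[OF cont]]) simp
  ultimately have "J = 0" by simp
  then have "\<forall>x\<in>{0..l}. (norm (E1 x))\<^sup>2 = 0"
    unfolding J_def using integral_eq_0_iff[OF cont \<open>l > 0\<close>] by simp
  then have "\<forall>x\<in>{0..s0}. E1 x = 0" using s0 by auto
  then have "(E1 has_integral 0) {0..s0}" by (intro has_integral_is_0) auto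
  moreover have "(E1 has_integral E s0 - E 0) {0..s0}" using Ei[of 0 s0] s0 by simp
  ultimately have "E s0 - E 0 = 0" by (metis has_integral_unique)
  then show False using bc s0 by simp
qed

section \<open>The weak formulation through the primitive of the cavity\<close>

text \<open>F is a primitive of the cavity and E1 the derivative of E.\<close>
definition qn_weak ::
    "real \<Rightarrow> real \<Rightarrow> real \<Rightarrow> real \<Rightarrow> real \<Rightarrow> complex \<Rightarrow> (real \<Rightarrow> real) \<Rightarrow> (real \<Rightarrow> complex) \<Rightarrow> (real \<Rightarrow> complex) \<Rightarrow> bool" where
  "qn_weak l c q m M \<omega> F E E1 \<longleftrightarrow>
     F 0 = 0 \<and>
     (\<forall>s t. 0 \<le> s \<longrightarrow> s \<le> t \<longrightarrow> t \<le> l \<longrightarrow> m * (t - s) \<le> F t - F s \<and> F t - F s \<le> M * (t - s)) \<and>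
     continuous_on {0..l} E1 \<and>
     (\<forall>s\<in>{0..l}. (E1 has_integral E s) {0..s}) \<and>
     (\<forall>s\<in>{0..l}. E1 s = E1 0 - \<omega>\<^sup>2 / (complex_of_real c)\<^sup>2 *
        (of_real (F s) * E s - integral {0..s} (\<lambda>x. of_real (F x) * E1 x))) \<and>
     \<i> * \<omega> * complex_of_real (sqrt q / c) * E l = E1 l"

lemma qn_solution_imp_weak:
  assumes "l > 0" "admissible_cavity l m M \<epsilon>" "0 \<le> m" "m \<le> M" "qn_solution l c q \<epsilon> \<omega> E"
  shows "\<exists>F E1. qn_weak l c q m M \<omega> F E E1"
proof -
  obtain f F E1 where f: "\<forall>x. m \<le> f x \<and> f x \<le> M" and F0: "F 0 = 0"
    and fF: "\<And>s t. \<lbrakk>0 \<le> s; s \<le> t; t \<le> l\<rbrakk> \<Longrightarrow> (f has_integral F t - F s) {s..t}"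
    and E1: "continuous_on {0..l} E1"
    and Ei: "\<And>s t. \<lbrakk>0 \<le> s; s \<le> t; t \<le> l\<rbrakk> \<Longrightarrow> (E1 has_integral E t - E s) {s..t}"
    and gi: "\<And>s t. \<lbrakk>0 \<le> s; s \<le> t; t \<le> l\<rbrakk> \<Longrightarrow>
      ((\<lambda>x. - (\<omega>\<^sup>2 / (complex_of_real c)\<^sup>2) * of_real (f x) * E x) has_integral E1 t - E1 s) {s..t}"
    and bc: "E 0 = 0" "\<i> * \<omega> * complex_of_real (sqrt q / c) * E l = E1 l"
    using qn_solution_integral_form[OF assms] by auto
  have "m * (t - s) \<le> F t - F s \<and> F t - F s \<le> M * (t - s)" if st: "0 \<le> s" "s \<le> t" "t \<le> l" for s t
    using has_integral_le[OF has_integral_const_real[of m s t] fF[OF st]]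
      has_integral_le[OF fF[OF st] has_integral_const_real[of M s t]] f st
    by (simp add: mult.commute)
  moreover have "(E1 has_integral E s) {0..s}" if "s \<in> {0..l}" for s
    using Ei[of 0 s] that bc by simp
  moreover have "E1 s = E1 0 - \<omega>\<^sup>2 / (complex_of_real c)\<^sup>2 *
        (of_real (F s) * E s - integral {0..s} (\<lambda>x. of_real (F x) * E1 x))" if s: "s \<in> {0..l}" for s
  proof -
    have "\<bar>f x\<bar> \<le> M" for x using f assms(3) by (metis abs_of_nonneg order_trans)
    then have "((\<lambda>x. of_real (f x) * E x) has_integral
       of_real (F s) * E s - of_real (F 0) * E 0 - integral {0..s} (\<lambda>x. of_real (F x) * E1 x)) {0..s}"
      using s fF Ei continuous_on_subset[OF E1] by (intro has_integral_mult_primitive[where C = M]) auto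
    \<comment> \<open>The boundary term of the integration by parts at 0 drops out because
      \<open>F 0 = 0\<close>.\<close>
    from has_integral_mult_right[OF this, of "- (\<omega>\<^sup>2 / (complex_of_real c)\<^sup>2)"]
    have "((\<lambda>x. - (\<omega>\<^sup>2 / (complex_of_real c)\<^sup>2) * of_real (f x) * E x) has_integral
       - (\<omega>\<^sup>2 / (complex_of_real c)\<^sup>2) * (of_real (F s) * E s - integral {0..s} (\<lambda>x. of_real (F x) * E1 x))) {0..s}"
      using F0 by (simp add: mult.assoc)
    moreover have "((\<lambda>x. - (\<omega>\<^sup>2 / (complex_of_real c)\<^sup>2) * of_real (f x) * E x) has_integral E1 s - E1 0) {0..s}"
      using gi[of 0 s] s by simp
    ultimately have "- (\<omega>\<^sup>2 / (complex_of_real c)\<^sup>2) * (of_real (F s) * E s - integral {0..s} (\<lambda>x. of_real (F x) * E1 x)) = E1 s - E1 0"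
      by (rule has_integral_unique)
    then show ?thesis by (simp add: algebra_simps)
  qed
  ultimately show ?thesis using F0 E1 bc(2) unfolding qn_weak_def by blast
qed

lemma qn_weak_scaleR:
  assumes "qn_weak l c q m M \<omega> F E E1"
  shows "qn_weak l c q m M \<omega> F (\<lambda>s. r *\<^sub>R E s) (\<lambda>s. r *\<^sub>R E1 s)"
proof -
  have eq: "E1 s = E1 0 - \<omega>\<^sup>2 / (complex_of_real c)\<^sup>2 *
        (of_real (F s) * E s - integral {0..s} (\<lambda>x. of_real (F x) * E1 x))" if "s \<in> {0..l}" for s
    using assms that unfolding qn_weak_def by blast
  have "r *\<^sub>R E1 s = r *\<^sub>R E1 0 - \<omega>\<^sup>2 / (complex_of_real c)\<^sup>2 *
        (of_real (F s) * r *\<^sub>R E s - integral {0..s} (\<lambda>x. of_real (F x) * r *\<^sub>R E1 x))" if "s \<in> {0..l}" for s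
  proof -
    have "integral {0..s} (\<lambda>x. of_real (F x) * r *\<^sub>R E1 x) = r *\<^sub>R integral {0..s} (\<lambda>x. of_real (F x) * E1 x)"
      using integral_cmul[of "{0..s}" r "\<lambda>x. of_real (F x) * E1 x"] by simp
    then have "r *\<^sub>R E1 0 - \<omega>\<^sup>2 / (complex_of_real c)\<^sup>2 *
        (of_real (F s) * r *\<^sub>R E s - integral {0..s} (\<lambda>x. of_real (F x) * r *\<^sub>R E1 x))
      = r *\<^sub>R (E1 0 - \<omega>\<^sup>2 / (complex_of_real c)\<^sup>2 *
        (of_real (F s) * E s - integral {0..s} (\<lambda>x. of_real (F x) * E1 x)))"
      by (simp only: scaleR_diff_right[symmetric] mult_scaleR_right)
    then show ?thesis unfolding eq[OF that, symmetric] by (rule sym)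
  qed
  moreover have "((\<lambda>s. r *\<^sub>R E1 s) has_integral r *\<^sub>R E s) {0..s}" if "s \<in> {0..l}" for s
    using assms that unfolding qn_weak_def by (intro has_integral_cmul) blast
  moreover have "\<i> * \<omega> * complex_of_real (sqrt q / c) * (r *\<^sub>R E l) = r *\<^sub>R E1 l"
    using assms unfolding qn_weak_def by (metis mult_scaleR_right)
  moreover have "continuous_on {0..l} (\<lambda>s. r *\<^sub>R E1 s)"
    using assms unfolding qn_weak_def by (intro continuous_intros) blast
  ultimately show ?thesis using assms unfolding qn_weak_def by blast
qed

lemma qn_weak_E_has_integral:
  assumes "qn_weak l c q m M \<omega> F E E1" and st: "0 \<le> s" "s \<le> t" "t \<le> l"
  shows "(E1 has_integral E t - E s) {s..t}"
proof -
  have "s \<in> {0..l}" "t \<in> {0..l}" using st by auto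
  then have i: "(E1 has_integral E s) {0..s}" "(E1 has_integral E t) {0..t}"
    using assms(1) unfolding qn_weak_def by blast+
  then have "E1 integrable_on {s..t}"
    using integrable_subinterval_real[of E1 0 t s t] st by auto
  then have "(E1 has_integral integral {s..t} E1) {s..t}" by (rule integrable_integral)
  moreover from has_integral_combine[OF st(1,2) i(1) this]
  have "E s + integral {s..t} E1 = E t" using i(2) has_integral_unique by blast
  ultimately show ?thesis by (metis add_diff_cancel_left')
qed

text \<open>Reverses the integration by parts. The slope bounds on \<open>F\<close> produce a
  density, and subtracting the weak equation at \<open>s\<close> from that at \<open>t\<close> gives
  its integral against \<open>E\<close>.\<close>

lemma qn_weak_density:
  assumes "l > 0" "m > 0" and w: "qn_weak l c q m M \<omega> F E E1"
  shows "\<exists>f\<in>borel_measurable borel. (\<forall>x. m \<le> f x \<and> f x \<le> M) \<and>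
    (\<forall>s t. 0 \<le> s \<longrightarrow> s \<le> t \<longrightarrow> t \<le> l \<longrightarrow>
      ((\<lambda>x. - (\<omega>\<^sup>2 / (complex_of_real c)\<^sup>2) * of_real (f x) * E x) has_integral E1 t - E1 s) {s..t})"
proof -
  define k where "k = \<omega>\<^sup>2 / (complex_of_real c)\<^sup>2"
  have E1: "continuous_on {0..l} E1"
    and Fb: "\<And>s t. \<lbrakk>0 \<le> s; s \<le> t; t \<le> l\<rbrakk> \<Longrightarrow> m * (t - s) \<le> F t - F s \<and> F t - F s \<le> M * (t - s)"
    and eq: "\<And>s. s \<in> {0..l} \<Longrightarrow> E1 s = E1 0 - k *
        (of_real (F s) * E s - integral {0..s} (\<lambda>x. of_real (F x) * E1 x))"
    using w unfolding qn_weak_def k_def by blast+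
  obtain f where f: "f \<in> borel_measurable borel" "\<forall>x. m \<le> f x \<and> f x \<le> M"
    and fF: "\<And>s t. \<lbrakk>0 \<le> s; s \<le> t; t \<le> l\<rbrakk> \<Longrightarrow> (f has_integral F t - F s) {s..t}"
    using bilipschitz_real_integral[OF assms(1,2) Fb] by auto
  have fM: "\<bar>f x\<bar> \<le> M" for x using f(2) assms(2) by (metis abs_of_nonneg less_imp_le order_trans)
  have "M-lipschitz_on {0..l} F"
    by (rule has_integral_imp_lipschitz_on[OF fF]) (use fM in \<open>auto intro: order_trans[OF abs_ge_zero]\<close>)
  then have "continuous_on {0..l} F" by (rule lipschitz_on_continuous_on)
  then have FE: "(\<lambda>x. of_real (F x) * E1 x) integrable_on {0..l}"
    by (intro integrable_continuous_real continuous_intros E1)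
  have "((\<lambda>x. - k * of_real (f x) * E x) has_integral E1 t - E1 s) {s..t}"
    if st: "0 \<le> s" "s \<le> t" "t \<le> l" for s t
  proof -
    have 1: "((\<lambda>x. of_real (f x) * E x) has_integral
       of_real (F t) * E t - of_real (F s) * E s - integral {s..t} (\<lambda>x. of_real (F x) * E1 x)) {s..t}"
      using st fF fM qn_weak_E_has_integral[OF w] continuous_on_subset[OF E1]
      by (intro has_integral_mult_primitive[where C = M]) auto
    have "(\<lambda>x. of_real (F x) * E1 x) integrable_on {0..t}"
      using integrable_subinterval_real[OF FE] st by auto
    then have 2: "integral {0..s} (\<lambda>x. of_real (F x) * E1 x) + integral {s..t} (\<lambda>x. of_real (F x) * E1 x)
        = integral {0..t} (\<lambda>x. of_real (F x) * E1 x)"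
      using st Henstock_Kurzweil_Integration.integral_combine by blast
    have "- k * (of_real (F t) * E t - of_real (F s) * E s - integral {s..t} (\<lambda>x. of_real (F x) * E1 x)) = E1 t - E1 s"
      using eq[of s] eq[of t] st unfolding 2[symmetric] by (simp add: algebra_simps)
    then show ?thesis
      using has_integral_mult_right[OF 1, of "- k"] by (simp add: mult.assoc)
  qed
  then show ?thesis using f unfolding k_def by blast
qed

text \<open>The constants depend on the solution only through \<open>B\<close> and \<open>K\<close>,
  and not on the particular \<open>F\<close>. This uniformity supplies the equicontinuity for the
  compactness argument.\<close>

lemma qn_weak_lipschitz:
  assumes "l > 0" "m > 0" and w: "qn_weak l c q m M \<omega> F E E1"
    and E: "\<And>x. x \<in> {0..l} \<Longrightarrow> norm (E x) \<le> B" "\<And>x. x \<in> {0..l} \<Longrightarrow> norm (E1 x) \<le> B"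
    and K: "norm (\<omega>\<^sup>2 / (complex_of_real c)\<^sup>2) \<le> K"
  shows "B-lipschitz_on {0..l} E" "(K * M * B)-lipschitz_on {0..l} E1"
proof -
  have "norm (E 0) \<le> B" by (rule E(1)) (use assms(1) in auto)
  then have B: "B \<ge> 0" using norm_ge_zero[of "E 0"] by linarith
  have K0: "K \<ge> 0" using K norm_ge_zero order_trans by blast
  show "B-lipschitz_on {0..l} E"
    by (rule has_integral_imp_lipschitz_on[OF qn_weak_E_has_integral[OF w]]) (use B E in auto)
  obtain f where f: "\<forall>x. m \<le> f x \<and> f x \<le> M"
    and gi: "\<And>s t. \<lbrakk>0 \<le> s; s \<le> t; t \<le> l\<rbrakk> \<Longrightarrow>
      ((\<lambda>x. - (\<omega>\<^sup>2 / (complex_of_real c)\<^sup>2) * of_real (f x) * E x) has_integral E1 t - E1 s) {s..t}"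
    using qn_weak_density[OF assms(1,2) w] by auto
  have fM: "\<bar>f x\<bar> \<le> M" for x using f assms(2) by (metis abs_of_nonneg less_imp_le order_trans)
  then have M: "M \<ge> 0" using abs_ge_zero order_trans by blast
  show "(K * M * B)-lipschitz_on {0..l} E1"
  proof (rule has_integral_imp_lipschitz_on[OF gi])
    show "0 \<le> K * M * B" using K0 M B by simp
    show "norm (- (\<omega>\<^sup>2 / (complex_of_real c)\<^sup>2) * complex_of_real (f x) * E x) \<le> K * M * B"
      if "x \<in> {0..l}" for x
      using fM K E(1)[OF that] K0 M B unfolding norm_mult norm_minus_cancel norm_of_real
      by (intro mult_mono mult_nonneg_nonneg) auto
  qed
qed

lemma qn_weak_imp_solution:
  assumes "l > 0" "m > 0" and w: "qn_weak l c q m M \<omega> F E E1"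
  shows "\<exists>\<epsilon>. admissible_cavity l m M \<epsilon> \<and> qn_solution l c q \<epsilon> \<omega> E"
proof -
  obtain f where f: "f \<in> borel_measurable borel" "\<forall>x. m \<le> f x \<and> f x \<le> M"
    and gi: "\<And>s t. \<lbrakk>0 \<le> s; s \<le> t; t \<le> l\<rbrakk> \<Longrightarrow>
      ((\<lambda>x. - (\<omega>\<^sup>2 / (complex_of_real c)\<^sup>2) * of_real (f x) * E x) has_integral E1 t - E1 s) {s..t}"
    using qn_weak_density[OF assms] by auto
  have E1: "continuous_on {0..l} E1"
    and Ei: "\<And>s. s \<in> {0..l} \<Longrightarrow> (E1 has_integral E s) {0..s}"
    and bc: "\<i> * \<omega> * complex_of_real (sqrt q / c) * E l = E1 l"
    using w unfolding qn_weak_def by blast+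
  \<comment> \<open>\<open>E1\<close> is continuous, so its integral is differentiable at every
    point of \<open>{0..l}\<close>, as the definition of a solution demands, and not merely almost
    everywhere.\<close>
  have dE: "(E has_vector_derivative E1 s) (at s within {0..l})" if s: "s \<in> {0..l}" for s
  proof (rule has_vector_derivative_transform[OF s _ integral_has_vector_derivative[OF E1 s]])
    show "E x = integral {0..x} E1" if "x \<in> {0..l}" for x
      using Ei[OF that] by (simp add: integral_unique)
  qed
  then have E: "continuous_on {0..l} E"
    unfolding continuous_on_eq_continuous_within using has_vector_derivative_continuous by blast
  have bdd: "\<exists>B. \<forall>x\<in>{0..l}. norm (h x) \<le> B" if "continuous_on {0..l} h" for h :: "real \<Rightarrow> complex"
  proof -
    have "bounded (h ` {0..l})"
      using that compact_continuous_image compact_Icc compact_imp_bounded by blast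
    then show ?thesis by (auto simp: bounded_iff)
  qed
  obtain B B1 where B: "\<forall>x\<in>{0..l}. norm (E x) \<le> B" "\<forall>x\<in>{0..l}. norm (E1 x) \<le> B1"
    using bdd[OF E] bdd[OF E1] by blast
  have Emax: "norm (E x) \<le> max B B1" "norm (E1 x) \<le> max B B1" if "x \<in> {0..l}" for x
    using B that by (auto simp: le_max_iff_disj)
  note lip = qn_weak_lipschitz[OF assms Emax order_refl]
  obtain N where N: "negligible N" "\<forall>x\<in>{0<..<l} - N. (E1 has_vector_derivative
      - (\<omega>\<^sup>2 / (complex_of_real c)\<^sup>2) * of_real (f x) * E x) (at x)"
    using primitive_has_vector_derivative_ae[OF less_imp_le[OF assms(1)] gi] by blast
  have "admissible_cavity l m M f"
    unfolding admissible_cavity_def using f by (auto intro!: measurable_completion measurable_restrict_space1)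
  moreover have "qn_solution l c q f \<omega> E"
    unfolding qn_solution_def
  proof (intro exI[of _ E1] conjI ballI)
    show "abs_continuous_on_interval 0 l E" "abs_continuous_on_interval 0 l E1"
      using lip by (auto intro: lipschitz_on_imp_abs_continuous)
    show "AE s in lebesgue_on {0<..<l}. (E1 has_vector_derivative
                 - (\<omega>\<^sup>2 / (complex_of_real c)\<^sup>2) * complex_of_real (f s) * E s) (at s)"
      by (rule negligible_imp_AE_lebesgue_on[OF N(1)]) (use N(2) in auto)
    \<comment> \<open>The condition \<open>E 0 = 0\<close> is hidden in the weak formulation as the
      degenerate case \<open>s = 0\<close> of the integral clause.\<close>
    have "(E1 has_integral E 0) {0..0}" using Ei[of 0] assms(1) by simp
    moreover have "(E1 has_integral 0) {0..0}" by (rule has_integral_null_real) simp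
    ultimately show "E 0 = 0" by (rule has_integral_unique)
  qed (use dE bc in auto)
  ultimately show ?thesis by blast
qed

lemma qn_weak_F_lipschitz:
  assumes "l > 0" "m > 0" and w: "qn_weak l c q m M \<omega> F E E1"
  shows "M-lipschitz_on {0..l} F"
proof (rule lipschitz_on_leI)
  have Fb: "\<And>s t. \<lbrakk>0 \<le> s; s \<le> t; t \<le> l\<rbrakk> \<Longrightarrow> m * (t - s) \<le> F t - F s \<and> F t - F s \<le> M * (t - s)"
    using w unfolding qn_weak_def by blast
  have "m * (l - 0) \<le> M * (l - 0)" using Fb[of 0 l] assms(1) by linarith
  then have "m \<le> M" using assms(1) by (simp add: mult_le_cancel_right)
  then show "0 \<le> M" using assms(2) by simp
  fix x y assume xy: "x \<in> {0..l}" "y \<in> {0..l}" "x \<le> y"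
  then have "m * (y - x) \<le> F y - F x" "F y - F x \<le> M * (y - x)" using Fb[of x y] by auto
  moreover have "0 \<le> m * (y - x)" using xy assms(2) by simp
  ultimately show "dist (F x) (F y) \<le> M * dist x y" using xy by (simp add: dist_real_def)
qed

section \<open>Closedness and compactness of the weak problem\<close>

text \<open>Every clause is a pointwise equality or a non-strict inequality, the continuity of
  \<open>E1\<close>, or an integral of uniformly convergent continuous functions, and each of these
  is stable under uniform limits.\<close>

lemma qn_weak_limit:
  assumes w: "\<And>n. qn_weak l c q m M (\<omega> n) (F n) (E n) (E1 n)" and "l > 0" "m > 0"
    and \<omega>: "\<omega> \<longlonglongrightarrow> \<omega>'"
    and F: "uniform_limit {0..l} F F' sequentially"
    and E: "uniform_limit {0..l} E E' sequentially"
    and E1: "uniform_limit {0..l} E1 E1' sequentially"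
  shows "qn_weak l c q m M \<omega>' F' E' E1'"
proof -
  have F0: "F n 0 = 0"
    and Fb: "\<And>s t. \<lbrakk>0 \<le> s; s \<le> t; t \<le> l\<rbrakk> \<Longrightarrow> m * (t - s) \<le> F n t - F n s \<and> F n t - F n s \<le> M * (t - s)"
    and E1c: "continuous_on {0..l} (E1 n)"
    and Ei: "\<And>s. s \<in> {0..l} \<Longrightarrow> (E1 n has_integral E n s) {0..s}"
    and eq: "\<And>s. s \<in> {0..l} \<Longrightarrow> E1 n s = E1 n 0 - (\<omega> n)\<^sup>2 / (complex_of_real c)\<^sup>2 *
        (of_real (F n s) * E n s - integral {0..s} (\<lambda>x. of_real (F n x) * E1 n x))"
    and bc: "\<i> * \<omega> n * complex_of_real (sqrt q / c) * E n l = E1 n l" for n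
    using w[of n] unfolding qn_weak_def by blast+
  have Fc: "continuous_on {0..l} (F n)" for n by (rule lipschitz_on_continuous_on[OF qn_weak_F_lipschitz[OF assms(2,3) w]])
  note ptF = tendsto_uniform_limitI[OF F] and ptE = tendsto_uniform_limitI[OF E]
    and ptE1 = tendsto_uniform_limitI[OF E1]
  have E1'c: "continuous_on {0..l} E1'"
    by (rule uniform_limit_theorem[OF _ E1]) (use E1c in auto)
  have F'c: "continuous_on {0..l} F'"
    by (rule uniform_limit_theorem[OF _ F]) (use Fc in auto)
  have prod: "uniform_limit {0..l} (\<lambda>n x. complex_of_real (F n x) * E1 n x) (\<lambda>x. complex_of_real (F' x) * E1' x) sequentially"
  proof (rule uniform_lim_mult[OF bounded_linear.uniform_limit[OF bounded_linear_of_real F] E1])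
    show "bounded ((\<lambda>x. complex_of_real (F' x)) ` {0..l})"
      by (intro compact_imp_bounded compact_continuous_image compact_Icc continuous_intros F'c)
    show "bounded (E1' ` {0..l})"
      by (intro compact_imp_bounded compact_continuous_image compact_Icc E1'c)
  qed
  have int_lim: "(\<lambda>n. integral {0..s} (h n)) \<longlonglongrightarrow> integral {0..s} h'"
    if h: "uniform_limit {0..l} h h' sequentially" and hc: "\<And>n. continuous_on {0..l} (h n)" and s: "s \<in> {0..l}"
    for h :: "nat \<Rightarrow> real \<Rightarrow> complex" and h' s
  proof -
    have sub: "{0..s} \<subseteq> {0..l}" using s by auto
    show ?thesis
    proof (rule uniform_limit_integral[OF uniform_limit_on_subset[OF h sub]
        continuous_on_subset[OF hc sub] sequentially_bot])
      fix I J assume "\<And>n. (h n has_integral I n) {0..s}" "(h' has_integral J) {0..s}" "I \<longlonglongrightarrow> J"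
      moreover from this have "(\<lambda>n. integral {0..s} (h n)) = I" by (blast intro: integral_unique)
      ultimately show ?thesis by (simp add: integral_unique)
    qed
  qed
  have "F' 0 = 0"
    using ptF[of 0] F0 assms(2) LIMSEQ_unique[OF _ tendsto_const] by simp
  moreover have "m * (t - s) \<le> F' t - F' s \<and> F' t - F' s \<le> M * (t - s)" if "0 \<le> s" "s \<le> t" "t \<le> l" for s t
  proof -
    have lim: "(\<lambda>n. F n t - F n s) \<longlonglongrightarrow> F' t - F' s"
      using ptF[of s] ptF[of t] that by (intro tendsto_diff) auto
    show ?thesis
      using LIMSEQ_le_const[OF lim, of "m * (t - s)"] LIMSEQ_le_const2[OF lim, of "M * (t - s)"] Fb[OF that] by blast
  qed
  moreover have "(E1' has_integral E' s) {0..s}" if s: "s \<in> {0..l}" for s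
  proof -
    have "(\<lambda>n. E n s) \<longlonglongrightarrow> integral {0..s} E1'"
      using int_lim[OF E1 E1c s] integral_unique[OF Ei[OF s]] by simp
    then have "integral {0..s} E1' = E' s" using ptE[OF s] LIMSEQ_unique by blast
    moreover have "E1' integrable_on {0..s}"
      by (rule integrable_continuous_real[OF continuous_on_subset[OF E1'c]]) (use s in auto)
    ultimately show ?thesis by (metis integrable_integral)
  qed
  moreover have "E1' s = E1' 0 - \<omega>'\<^sup>2 / (complex_of_real c)\<^sup>2 *
        (of_real (F' s) * E' s - integral {0..s} (\<lambda>x. of_real (F' x) * E1' x))" if s: "s \<in> {0..l}" for s
  proof (rule LIMSEQ_unique[OF ptE1[OF s]])
    have 0: "0 \<in> {0..l}" using assms(2) by simp
    have "(\<lambda>n. E1 n 0 - (\<omega> n)\<^sup>2 / (complex_of_real c)\<^sup>2 *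
        (of_real (F n s) * E n s - integral {0..s} (\<lambda>x. of_real (F n x) * E1 n x)))
       \<longlonglongrightarrow> E1' 0 - \<omega>'\<^sup>2 / (complex_of_real c)\<^sup>2 *
        (of_real (F' s) * E' s - integral {0..s} (\<lambda>x. of_real (F' x) * E1' x))"
      \<comment> \<open>Division by the constant becomes multiplication by its inverse, so the limit
        rules raise no side condition that \<open>c\<close> is nonzero.\<close>
      unfolding divide_inverse
      by (intro tendsto_intros ptE1[OF 0] ptF[OF s] ptE[OF s] \<omega> int_lim[OF prod _ s] continuous_intros Fc E1c)
    then show "(\<lambda>n. E1 n s) \<longlonglongrightarrow> E1' 0 - \<omega>'\<^sup>2 / (complex_of_real c)\<^sup>2 *
        (of_real (F' s) * E' s - integral {0..s} (\<lambda>x. of_real (F' x) * E1' x))"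
      unfolding eq[OF s, symmetric] .
  qed
  moreover have "\<i> * \<omega>' * complex_of_real (sqrt q / c) * E' l = E1' l"
  proof (rule LIMSEQ_unique)
    have ll: "l \<in> {0..l}" using assms(2) by simp
    show "(\<lambda>n. E1 n l) \<longlonglongrightarrow> E1' l" by (rule ptE1[OF ll])
    show "(\<lambda>n. E1 n l) \<longlonglongrightarrow> \<i> * \<omega>' * complex_of_real (sqrt q / c) * E' l"
      unfolding bc[symmetric] by (intro tendsto_intros \<omega> ptE[OF ll])
  qed
  ultimately show ?thesis using E1'c unfolding qn_weak_def by blast
qed

text \<open>The problem is linear for fixed \<open>F\<close> and \<omega>, so a solution may be
  divided by the maximum of the pair norm. Using the pair bounds \<open>E\<close> and
  \<open>E1\<close> at once, and this maximum is attained by continuity.\<close>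

lemma qn_weak_normalized:
  assumes "l > 0" and w: "qn_weak l c q m M \<omega> F E E1" and nz: "\<exists>s\<in>{0..l}. E s \<noteq> 0"
  shows "\<exists>E E1. qn_weak l c q m M \<omega> F E E1 \<and> (\<forall>s\<in>{0..l}. norm (E s, E1 s) \<le> 1) \<and>
    (\<exists>s\<in>{0..l}. norm (E s, E1 s) = 1)"
proof -
  have E1c: "continuous_on {0..l} E1"
    and Ei: "\<And>s. s \<in> {0..l} \<Longrightarrow> (E1 has_integral E s) {0..s}"
    using w unfolding qn_weak_def by blast+
  have "continuous_on {0..l} (\<lambda>s. integral {0..s} E1)"
    by (rule indefinite_integral_continuous_1[OF integrable_continuous_real[OF E1c]])
  then have "continuous_on {0..l} E"
    using integral_unique[OF Ei] by (rule continuous_on_eq)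
  then have "continuous_on {0..l} (\<lambda>s. norm (E s, E1 s))"
    by (intro continuous_intros E1c)
  then obtain s0 where s0: "s0 \<in> {0..l}" "\<forall>s\<in>{0..l}. norm (E s, E1 s) \<le> norm (E s0, E1 s0)"
    using continuous_attains_sup[of "{0..l}" "\<lambda>s. norm (E s, E1 s)"] assms(1) by auto
  define r where "r = norm (E s0, E1 s0)"
  obtain s1 where s1: "s1 \<in> {0..l}" "E s1 \<noteq> 0" using nz by blast
  have "0 < norm (E s1)" using s1 by simp
  also have "\<dots> \<le> norm (E s1, E1 s1)" using norm_fst_le[of "E s1" "E1 s1"] by simp
  also have "\<dots> \<le> r" using s0(2) s1(1) unfolding r_def by blast
  finally have "r > 0" .
  have nrm: "norm ((1 / r) *\<^sub>R E s, (1 / r) *\<^sub>R E1 s) = norm (E s, E1 s) / r" for s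
  proof -
    have "((1 / r) *\<^sub>R E s, (1 / r) *\<^sub>R E1 s) = (1 / r) *\<^sub>R (E s, E1 s)" by (simp only: scaleR_Pair)
    then show ?thesis using \<open>r > 0\<close> by (simp only: norm_scaleR) simp
  qed
  have "norm (E s, E1 s) / r \<le> 1" if "s \<in> {0..l}" for s
    using s0(2) that \<open>r > 0\<close> unfolding r_def[symmetric] by (simp add: divide_le_eq)
  moreover have "norm (E s0, E1 s0) / r = 1" using \<open>r > 0\<close> unfolding r_def[symmetric] by simp
  ultimately show ?thesis
    using qn_weak_scaleR[OF w, of "1 / r"] s0(1)
    by (intro exI[of _ "\<lambda>s. (1 / r) *\<^sub>R E s"] exI[of _ "\<lambda>s. (1 / r) *\<^sub>R E1 s"]) (auto simp only: nrm)
qed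

text \<open>The norm-one point may move with \<open>n\<close>, yet uniform convergence prevents it
  from being lost: if the limit of \<open>E\<close> vanished, so would that of \<open>E1\<close>,
  and both components would become uniformly small.\<close>

lemma qn_weak_compactness:
  assumes w: "\<And>n. qn_weak l c q m M (\<omega> n) (F n) (E n) (E1 n)" and "l > 0" "m > 0"
    and \<omega>: "\<omega> \<longlonglongrightarrow> \<omega>'"
    and le1: "\<And>n s. s \<in> {0..l} \<Longrightarrow> norm (E n s, E1 n s) \<le> 1"
    and eq1: "\<And>n. \<exists>s\<in>{0..l}. norm (E n s, E1 n s) = 1"
  shows "\<exists>F' E' E1'. qn_weak l c q m M \<omega>' F' E' E1' \<and> (\<exists>s\<in>{0..l}. E' s \<noteq> 0)"
proof -
  have "(\<lambda>n. (\<omega> n)\<^sup>2 / (complex_of_real c)\<^sup>2) \<longlonglongrightarrow> \<omega>'\<^sup>2 / (complex_of_real c)\<^sup>2"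
    unfolding divide_inverse by (intro tendsto_intros \<omega>)
  then have "Bseq (\<lambda>n. (\<omega> n)\<^sup>2 / (complex_of_real c)\<^sup>2)"
    using convergentI convergent_imp_Bseq by blast
  then obtain K where K: "K > 0" "\<And>n. norm ((\<omega> n)\<^sup>2 / (complex_of_real c)\<^sup>2) \<le> K"
    unfolding Bseq_def by blast
  have F0: "F n 0 = 0" for n using w[of n] unfolding qn_weak_def by blast
  note MF = qn_weak_F_lipschitz[OF assms(2,3) w]
  have M: "M \<ge> 0" by (rule lipschitz_on_nonneg[OF MF])
  have bnd: "norm (E n s) \<le> 1" "norm (E1 n s) \<le> 1" if "s \<in> {0..l}" for n s
    using le1[OF that, of n] norm_fst_le[of "E n s" "E1 n s"] norm_snd_le[of "E1 n s" "E n s"] by simp_all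
  note lip = qn_weak_lipschitz[OF assms(2,3) w bnd K(2)]
  \<comment> \<open>Bundling the three functions into one map lets a single application of
    Arzela-Ascoli choose a common subsequence.\<close>
  define H where "H n s = (E n s, E1 n s, F n s)" for n s
  \<comment> \<open>The sum of the Lipschitz constants of \<open>E n\<close>, \<open>E1 n\<close>
    and \<open>F n\<close>, with \<open>B = 1\<close> from the normalization.\<close>
  define L where "L = 1 + (K * M + M)"
  have L: "L > 0" using K M by (simp add: L_def add_pos_nonneg)
  have Hlip: "norm (H n x - H n y) \<le> L * norm (x - y)" if "x \<in> {0..l}" "y \<in> {0..l}" for n x y
  proof -
    have "norm (H n x - H n y) \<le> norm (E n x - E n y) + norm (E1 n x - E1 n y, F n x - F n y)"
      unfolding H_def diff_Pair by (rule norm_Pair_le)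
    also have "norm (E1 n x - E1 n y, F n x - F n y) \<le> norm (E1 n x - E1 n y) + norm (F n x - F n y)"
      by (rule norm_Pair_le)
    also have "norm (E n x - E n y) \<le> 1 * norm (x - y)"
      using lipschitz_onD[OF lip(1) that] by (simp add: dist_norm)
    also have "norm (E1 n x - E1 n y) \<le> K * M * 1 * norm (x - y)"
      using lipschitz_onD[OF lip(2) that] by (simp add: dist_norm)
    also have "norm (F n x - F n y) \<le> M * norm (x - y)"
      using lipschitz_onD[OF MF that] by (simp add: dist_norm)
    finally show ?thesis using norm_ge_zero[of "x - y"] by (simp add: L_def algebra_simps)
  qed
  \<comment> \<open>At 0 the components contribute at most 1, 1 and 0; the Lipschitz bound adds at
    most \<open>L * l\<close>.\<close>
  have Hbnd: "norm (H n x) \<le> 2 + L * l" if x: "x \<in> {0..l}" for n x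
  proof -
    have 0: "0 \<in> {0..l}" using assms(2) by simp
    have "norm (H n 0) \<le> norm (E n 0) + norm (E1 n 0, F n 0)"
      unfolding H_def by (rule norm_Pair_le)
    also have "norm (E1 n 0, F n 0) \<le> norm (E1 n 0) + norm (F n 0)" by (rule norm_Pair_le)
    finally have "norm (H n 0) \<le> 2" using bnd[OF 0, of n] F0[of n] by simp
    moreover have "norm (H n x - H n 0) \<le> L * x" "L * x \<le> L * l"
      using Hlip[OF x 0, of n] x L by auto
    ultimately show ?thesis using norm_triangle_sub[of "H n x" "H n 0"] by linarith
  qed
  obtain g k where k: "strict_mono (k :: nat \<Rightarrow> nat)"
    and g: "\<And>e. 0 < e \<Longrightarrow> \<exists>N. \<forall>n x. n \<ge> N \<and> x \<in> {0..l} \<longrightarrow> norm (H (k n) x - g x) < e"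
  proof (rule Arzela_Ascoli[of "{0..l}" H "2 + L * l"])
    fix x e :: real assume "x \<in> {0..l}" "0 < e"
    show "\<exists>d. 0 < d \<and> (\<forall>n y. y \<in> {0..l} \<and> norm (x - y) < d \<longrightarrow> norm (H n x - H n y) < e)"
    proof (intro exI[of _ "e / L"] conjI allI impI)
      fix n y assume "y \<in> {0..l} \<and> norm (x - y) < e / L"
      then show "norm (H n x - H n y) < e"
        using Hlip[OF \<open>x \<in> {0..l}\<close>, of y n] L by (simp add: field_simps)
    qed (use L \<open>0 < e\<close> in simp)
  qed (use Hbnd in auto)
  have ul: "uniform_limit {0..l} (\<lambda>n. H (k n)) g sequentially"
    unfolding uniform_limit_iff eventually_sequentially dist_norm using g by meson
  define E' E1' F' where "E' x = fst (g x)" and "E1' x = fst (snd (g x))" and "F' x = snd (snd (g x))" for x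
  have ulE: "uniform_limit {0..l} (\<lambda>n. E (k n)) E' sequentially"
    using bounded_linear.uniform_limit[OF bounded_linear_fst ul]
    by (simp add: H_def E'_def[abs_def])
  have ul2: "uniform_limit {0..l} (\<lambda>n x. snd (H (k n) x)) (\<lambda>x. snd (g x)) sequentially"
    by (rule bounded_linear.uniform_limit[OF bounded_linear_snd ul])
  have ulE1: "uniform_limit {0..l} (\<lambda>n. E1 (k n)) E1' sequentially"
    using bounded_linear.uniform_limit[OF bounded_linear_fst ul2]
    by (simp add: H_def E1'_def[abs_def])
  have ulF: "uniform_limit {0..l} (\<lambda>n. F (k n)) F' sequentially"
    using bounded_linear.uniform_limit[OF bounded_linear_snd ul2]
    by (simp add: H_def F'_def[abs_def])
  have "(\<lambda>n. \<omega> (k n)) \<longlonglongrightarrow> \<omega>'"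
    using LIMSEQ_subseq_LIMSEQ[OF \<omega> k] by (simp add: o_def)
  then have w': "qn_weak l c q m M \<omega>' F' E' E1'"
    by (intro qn_weak_limit[OF w assms(2,3) _ ulF ulE ulE1])
  moreover have "\<exists>s\<in>{0..l}. E' s \<noteq> 0"
  proof (rule ccontr)
    assume "\<not> (\<exists>s\<in>{0..l}. E' s \<noteq> 0)"
    then have E0: "\<And>s. s \<in> {0..l} \<Longrightarrow> E' s = 0" by blast
    have E1c: "continuous_on {0..l} E1'"
      and Ei: "\<And>s. s \<in> {0..l} \<Longrightarrow> (E1' has_integral E' s) {0..s}"
      using w' unfolding qn_weak_def by blast+
    have E10: "E1' s = 0" if s: "s \<in> {0..l}" for s
    proof -
      have "((\<lambda>_. 0) has_vector_derivative E1' s) (at s within {0..l})"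
      proof (rule has_vector_derivative_transform[OF s _ integral_has_vector_derivative[OF E1c s]])
        show "0 = integral {0..x} E1'" if "x \<in> {0..l}" for x
          using integral_unique[OF Ei[OF that]] E0[OF that] by simp
      qed
      moreover have "((\<lambda>_. 0) has_vector_derivative (0::complex)) (at s within {0..l})" by simp
      ultimately show ?thesis
        by (rule vector_derivative_unique_within_closed_interval[unfolded cbox_interval, OF assms(2) s])
    qed
    \<comment> \<open>With each component below 1/2, the norm of the pair stays below 1 everywhere,
      against \<open>eq1\<close>.\<close>
    obtain N where N: "\<forall>x\<in>{0..l}. norm (E (k N) x) < 1/2" "\<forall>x\<in>{0..l}. norm (E1 (k N) x) < 1/2"
    proof -
      have "\<forall>\<^sub>F n in sequentially. (\<forall>x\<in>{0..l}. dist (E (k n) x) (E' x) < 1/2)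
          \<and> (\<forall>x\<in>{0..l}. dist (E1 (k n) x) (E1' x) < 1/2)"
        by (intro eventually_conj uniform_limitD[OF ulE] uniform_limitD[OF ulE1]) auto
      then obtain N where "(\<forall>x\<in>{0..l}. dist (E (k N) x) (E' x) < 1/2)
          \<and> (\<forall>x\<in>{0..l}. dist (E1 (k N) x) (E1' x) < 1/2)"
        using eventually_happens'[OF sequentially_bot] by blast
      then show thesis using that[of N] E0 E10 by simp
    qed
    obtain s where s: "s \<in> {0..l}" "norm (E (k N) s, E1 (k N) s) = 1" using eq1 by blast
    then show False
      using norm_Pair_le[of "E (k N) s" "E1 (k N) s"] N s(1) by (smt (verit) field_sum_of_halves)
  qed
  ultimately show ?thesis by blast
qed

section \<open>Attainment of the minimal decay rate\<close>

theorem lemma1: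
  fixes l c eps_inf eps1 eps2 \<alpha> :: real
  assumes "l > 0" and "c > 0" and "eps_inf \<ge> 1"
    and "1 \<le> eps1" and "eps1 < eps2"
    and "admissible_frequency l c eps_inf eps1 eps2 \<alpha>"
  shows "\<exists>(\<beta>_min::real) \<epsilon>.
           admissible_cavity l eps1 eps2 \<epsilon> \<and>
           admissible_pair l c eps_inf eps1 eps2
             (complex_of_real \<alpha> - \<i> * complex_of_real \<beta>_min) \<epsilon> \<and>
           (\<forall>\<omega>' \<epsilon>'. admissible_pair l c eps_inf eps1 eps2 \<omega>' \<epsilon>' \<and> Re \<omega>' = \<alpha>
              \<longrightarrow> \<beta>_min \<le> - Im \<omega>')"
proof -
  \<comment> \<open>Since \<beta> = - Im \<omega>, the least decay rate is minus the supremum of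
    \<open>S\<close>; what has to be shown is that the supremum is attained.\<close>
  define S where "S = {y. \<exists>\<epsilon>. admissible_pair l c eps_inf eps1 eps2 (Complex \<alpha> y) \<epsilon>}"
  have S: "Im \<omega> \<in> S" if "admissible_pair l c eps_inf eps1 eps2 \<omega> \<epsilon>" "Re \<omega> = \<alpha>" for \<omega> \<epsilon>
    using that complex_surj[of \<omega>] unfolding S_def by auto
  have ne: "S \<noteq> {}" using assms(6) S unfolding admissible_frequency_def by blast
  have le0: "y \<le> 0" if yS: "y \<in> S" for y
  proof -
    obtain \<epsilon> where "admissible_pair l c eps_inf eps1 eps2 (Complex \<alpha> y) \<epsilon>"
      using yS unfolding S_def by blast
    then have "Im (Complex \<alpha> y) \<le> 0"
      unfolding admissible_pair_def using assms
      by (intro qn_eigenvalue_Im_le_0[of l c eps_inf eps1 eps2 \<epsilon>]) auto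
    then show ?thesis by simp
  qed
  then have bdd: "bdd_above S" by (meson bdd_aboveI)
  have "Sup S \<in> closure S" by (rule closure_contains_Sup[OF ne bdd])
  then obtain y where y: "\<And>n. y n \<in> S" "y \<longlonglongrightarrow> Sup S"
    unfolding closure_sequential by blast
  have "\<exists>F E E1. qn_weak l c eps_inf eps1 eps2 (Complex \<alpha> (y n)) F E E1 \<and>
    (\<forall>s\<in>{0..l}. norm (E s, E1 s) \<le> 1) \<and> (\<exists>s\<in>{0..l}. norm (E s, E1 s) = 1)" for n
  proof -
    obtain \<epsilon> E where "admissible_cavity l eps1 eps2 \<epsilon>"
        "qn_solution l c eps_inf \<epsilon> (Complex \<alpha> (y n)) E" and nz: "\<exists>s\<in>{0..l}. E s \<noteq> 0"
      using y(1)[of n] unfolding S_def admissible_pair_def qn_eigenvalue_def by blast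
    then obtain F E1 where "qn_weak l c eps_inf eps1 eps2 (Complex \<alpha> (y n)) F E E1"
      using qn_solution_imp_weak[of l eps1 eps2 \<epsilon>] assms by fastforce
    from qn_weak_normalized[OF assms(1) this nz] show ?thesis by blast
  qed
  then obtain F E E1 where w: "\<And>n. qn_weak l c eps_inf eps1 eps2 (Complex \<alpha> (y n)) (F n) (E n) (E1 n)"
    and le1: "\<And>n s. s \<in> {0..l} \<Longrightarrow> norm (E n s, E1 n s) \<le> 1"
    and eq1: "\<And>n. \<exists>s\<in>{0..l}. norm (E n s, E1 n s) = 1"
    by metis
  \<comment> \<open>The real part is fixed and the supremum finite, so the full sequence of
    frequencies converges before any subsequence is chosen.\<close>
  have lim: "(\<lambda>n. Complex \<alpha> (y n)) \<longlonglongrightarrow> Complex \<alpha> (Sup S)"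
    by (intro tendsto_Complex tendsto_const y)
  have "eps1 > 0" using assms(4) by simp
  have "\<exists>F' E' E1'. qn_weak l c eps_inf eps1 eps2 (Complex \<alpha> (Sup S)) F' E' E1' \<and> (\<exists>s\<in>{0..l}. E' s \<noteq> 0)"
    by (rule qn_weak_compactness[OF w assms(1) \<open>eps1 > 0\<close> lim]) (use le1 eq1 in auto)
  then obtain F' E' E1' where w': "qn_weak l c eps_inf eps1 eps2 (Complex \<alpha> (Sup S)) F' E' E1'"
    and nz: "\<exists>s\<in>{0..l}. E' s \<noteq> 0"
    by blast
  obtain \<epsilon> where "admissible_cavity l eps1 eps2 \<epsilon>" "qn_solution l c eps_inf \<epsilon> (Complex \<alpha> (Sup S)) E'"
    using qn_weak_imp_solution[OF assms(1) \<open>eps1 > 0\<close> w'] by blast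
  then have pair: "admissible_cavity l eps1 eps2 \<epsilon>"
      "admissible_pair l c eps_inf eps1 eps2 (Complex \<alpha> (Sup S)) \<epsilon>"
    using nz unfolding admissible_pair_def qn_eigenvalue_def by blast+
  have "complex_of_real \<alpha> - \<i> * complex_of_real (- Sup S) = Complex \<alpha> (Sup S)"
    by (simp add: complex_eq_iff)
  moreover have "- Sup S \<le> - Im \<omega>'" if "admissible_pair l c eps_inf eps1 eps2 \<omega>' \<epsilon>'" "Re \<omega>' = \<alpha>" for \<omega>' \<epsilon>'
    using cSup_upper[OF S[OF that] bdd] by simp
  ultimately show ?thesis using pair by (intro exI[of _ "- Sup S"] exI[of _ \<epsilon>]) auto
qed

end
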